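(* Under the standing assumptions in the context, almost surely on the event $\{\tau<\infty\}$, the process $(Y_{\tau+i}-Y_\tau)_{i\ge0}$, under either of the conditional laws $\mathbb P(\,\cdot\mid\tau,(Y_i)_{0\le i\le\tau})$ or $\mathbb P^{\angle}(\,\cdot\mid\tau,(Y_i)_{0\le i\le\tau})$, has the same distribution as $(Y_i)_{i\ge0}$ under $\mathbb P^{\angle}$.
   Context: Model: fix $q\in(0,1)$, $p_\circ,p_\bullet\in[0,1]$, $v_\circ=2p_\circ-1$, $v_\bullet=2p_\bullet-1$. Under $\mathbb P^\rho$: $\omega$ is a Poisson point process of intensity $\rho\sum_xP_x$ on the set $W$ of two-sided paths $w:\mathbb Z\to\mathbb Z$ with $|w(n+1)-w(n)|\le1$, where $P_x$ is the law of a two-sided lazy simple random walk (steps $-1,0,1$ with probabilities $\frac{1-q}2,q,\frac{1-q}2$) with $w(0)=x$; independently $(U_y)_{y\in\mathbb Z^2}$ are i.i.d. uniform $[0,1]$. $\mathcal T=\{(w(n),n): w\in\omega, n\in\mathbb Z\}$. For $y\in\mathbb Z^2$, $Y^y_0=y$, $Y^y_{i+1}=Y^y_i+(1,1)$ if ($Y^y_i\in\mathcal T$, $U_{Y^y_i}\le p_\bullet$) or ($Y^y_i\notin\mathcal T$, $U_{Y^y_i}\le p_\circ$), else $Y^y_{i+1}=Y^y_i+(-1,1)$; $X^y$ is its spatial coordinate; $Y=Y^{(0,0)}$, $X=X^{(0,0)}$. Standing assumptions: $v_\bullet>0$, $v_\circ>-1$, $\rho\in(0,\infty)$, and for some $v_\star\in(0,v_\bullet)$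 there are $c_0>0,\gamma>1$ with $\mathbb P^\rho(\exists n\in\mathbb N: X_n<nv_\star-L)\le c_0^{-1}e^{-c_0\log^\gamma L}$ for all $L\in\mathbb N$. Write $\mathbb P=\mathbb P^\rho$, $\bar v=v_\star/3$. Cones: $\angle(x,n)=(x,n)+\{(x',n')\in\mathbb Z_+^2: x'\ge\bar vn'\}$ and $\angle^{\mathrm{rev}}(x,n)=(x,n)+\{(x',n')\in\mathbb Z_-^2: x'<\bar vn'\}$ ($\mathbb Z_\pm$ include $0$). The trace of $w\in W$ is $\{(w(n),n):n\in\mathbb Z\}$. $W^{\times}_y$ is the set of $w$ whose trace intersects both $\angle(y)$ and $\angle^{\mathrm{rev}}(y)$. $A^y=\{Y^y_i\in\angle(y)\ \forall i\ge0\}$. Record times: $R_k=\inf\{n\ge0: X_n\ge(1-\bar v)k+\bar vn\}$, $k\in\mathbb N$. $\mathbb P^{\angle}(\cdot)=\mathbb P(\,\cdot\mid \omega(W^\times_{(0,0)})=0,\ A^{(0,0)})$. Regeneration index $\mathcal I=\inf\{k\in\mathbb N: \omega(W^\times_{Y_{R_k}})=0\text{ and }A^{Y_{R_k}}\text{ occurs}\}$ and regeneration time $\tau=R_{\mathcal I}$. *)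

theory Defs
  imports "HOL-Probability.Probability"
begin

definition Wpaths :: "(int \<Rightarrow> int) set" where
  "Wpaths = {w. \<forall>n. \<bar>w (n + 1) - w n\<bar> \<le> 1}"

definition path_space :: "(int \<Rightarrow> int) measure" where
  "path_space = PiM UNIV (\<lambda>_. count_space UNIV)"

definition step_pmf :: "real \<Rightarrow> int pmf" where
  "step_pmf q = embed_pmf (\<lambda>k. if k = 0 then q else if k = 1 \<or> k = -1 then (1 - q) / 2 else 0)"

text \<open>Two-sided path with w(0) = x and increments w(n+1) - w(n) = xi n.\<close>
definition walk_from :: "int \<Rightarrow> (int \<Rightarrow> int) \<Rightarrow> int \<Rightarrow> int" where
  "walk_from x xi n = (if 0 \<le> n then x + (\<Sum>k\<in>{0..<n}. xi k) else x - (\<Sum>k\<in>{n..<0}. xi k))"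

definition lsrw :: "real \<Rightarrow> int \<Rightarrow> (int \<Rightarrow> int) measure" where
  "lsrw q x = distr (PiM UNIV (\<lambda>_::int. measure_pmf (step_pmf q))) path_space (walk_from x)"

definition intensity :: "real \<Rightarrow> real \<Rightarrow> (int \<Rightarrow> int) set \<Rightarrow> ennreal" where
  "intensity \<rho> q A = ennreal \<rho> * (\<integral>\<^sup>+ x. emeasure (lsrw q x) A \<partial>count_space UNIV)"

text \<open>A point configuration om on paths is given by its multiplicity function;
  om(A) is the number of points (with multiplicity) in A.\<close>
definition count_in :: "((int \<Rightarrow> int) \<Rightarrow> nat) \<Rightarrow> (int \<Rightarrow> int) set \<Rightarrow> ennreal" where
  "count_in om A = (\<integral>\<^sup>+ w. of_nat (om w) \<partial>count_space A)"

definition rw_model ::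
  "'a measure \<Rightarrow> ('a \<Rightarrow> (int \<Rightarrow> int) \<Rightarrow> nat) \<Rightarrow> ('a \<Rightarrow> int \<times> int \<Rightarrow> real) \<Rightarrow> real \<Rightarrow> real \<Rightarrow> bool"
where
  "rw_model M om U \<rho> q \<longleftrightarrow>
     prob_space M \<and>
     \<comment> \<open>point-process counts are random variables\<close>
     (\<forall>A \<in> sets path_space. (\<lambda>\<xi>. count_in (om \<xi>) A) \<in> borel_measurable M) \<and>
     \<comment> \<open>Poisson counts\<close>
     (\<forall>A \<in> sets path_space. intensity \<rho> q A < \<infinity> \<longrightarrow>
        (\<forall>k::nat. measure M {\<xi> \<in> space M. count_in (om \<xi>) A = of_nat k}
            = exp (- enn2real (intensity \<rho> q A)) * enn2real (intensity \<rho> q A) ^ k / fact k)) \<and>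
     \<comment> \<open>independent counts on disjoint sets\<close>
     (\<forall>(As :: nat \<Rightarrow> (int \<Rightarrow> int) set) I. finite I \<and> (\<forall>i\<in>I. As i \<in> sets path_space)
        \<and> disjoint_family_on As I \<longrightarrow>
        prob_space.indep_vars M (\<lambda>_. borel) (\<lambda>i \<xi>. count_in (om \<xi>) (As i)) I) \<and>
     \<comment> \<open>i.i.d. uniform marks\<close>
     prob_space.indep_vars M (\<lambda>_. borel) (\<lambda>y \<xi>. U \<xi> y) UNIV \<and>
     (\<forall>y. distr M borel (\<lambda>\<xi>. U \<xi> y) = uniform_measure lborel {0..1}) \<and>
     \<comment> \<open>om independent of U\<close>
     prob_space.indep_set M
        (sigma_sets (space M) {(\<lambda>\<xi>. count_in (om \<xi>) A) -` S \<inter> space M | A S.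
             A \<in> sets path_space \<and> S \<in> sets borel})
        (sigma_sets (space M) {(\<lambda>\<xi>. U \<xi> y) -` S \<inter> space M | y S. S \<in> sets borel})"

definition occupied :: "((int \<Rightarrow> int) \<Rightarrow> nat) \<Rightarrow> (int \<times> int) set" where
  "occupied om = {(w n, n) | w n. 0 < om w}"

definition Ystep :: "real \<Rightarrow> real \<Rightarrow> ((int \<Rightarrow> int) \<Rightarrow> nat) \<Rightarrow> (int \<times> int \<Rightarrow> real) \<Rightarrow> int \<times> int \<Rightarrow> int \<times> int" where
  "Ystep pc pb om U z =
     (if (z \<in> occupied om \<and> U z \<le> pb) \<or> (z \<notin> occupied om \<and> U z \<le> pc)
      then (fst z + 1, snd z + 1) else (fst z - 1, snd z + 1))"

definition Ypos :: "real \<Rightarrow> real \<Rightarrow> ((int \<Rightarrow> int) \<Rightarrow> nat) \<Rightarrow> (int \<times> int \<Rightarrow> real) \<Rightarrow> int \<times> int \<Rightarrow> nat \<Rightarrow> int \<times> int" where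
  "Ypos pc pb om U y i = (Ystep pc pb om U ^^ i) y"

definition Xpos :: "real \<Rightarrow> real \<Rightarrow> ((int \<Rightarrow> int) \<Rightarrow> nat) \<Rightarrow> (int \<times> int \<Rightarrow> real) \<Rightarrow> int \<times> int \<Rightarrow> nat \<Rightarrow> int" where
  "Xpos pc pb om U y i = fst (Ypos pc pb om U y i)"

definition cone :: "real \<Rightarrow> int \<times> int \<Rightarrow> (int \<times> int) set" where
  "cone vb y = {(fst y + x', snd y + n') | x' n'. 0 \<le> x' \<and> 0 \<le> n' \<and> real_of_int x' \<ge> vb * real_of_int n'}"

definition cone_rev :: "real \<Rightarrow> int \<times> int \<Rightarrow> (int \<times> int) set" where
  "cone_rev vb y = {(fst y + x', snd y + n') | x' n'. x' \<le> 0 \<and> n' \<le> 0 \<and> real_of_int x' < vb * real_of_int n'}"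

definition path_trace :: "(int \<Rightarrow> int) \<Rightarrow> (int \<times> int) set" where
  "path_trace w = {(w n, n) | n. True}"

definition Wcross :: "real \<Rightarrow> int \<times> int \<Rightarrow> (int \<Rightarrow> int) set" where
  "Wcross vb y = {w \<in> Wpaths. path_trace w \<inter> cone vb y \<noteq> {} \<and> path_trace w \<inter> cone_rev vb y \<noteq> {}}"

definition stays_in_cone :: "real \<Rightarrow> real \<Rightarrow> real \<Rightarrow> ((int \<Rightarrow> int) \<Rightarrow> nat) \<Rightarrow> (int \<times> int \<Rightarrow> real) \<Rightarrow> int \<times> int \<Rightarrow> bool" where
  "stays_in_cone pc pb vb om U y \<longleftrightarrow> (\<forall>i. Ypos pc pb om U y i \<in> cone vb y)"

definition good_point :: "real \<Rightarrow> real \<Rightarrow> real \<Rightarrow> ((int \<Rightarrow> int) \<Rightarrow> nat) \<Rightarrow> (int \<times> int \<Rightarrow> real) \<Rightarrow> int \<times> int \<Rightarrow> bool" where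
  "good_point pc pb vb om U y \<longleftrightarrow> count_in om (Wcross vb y) = 0 \<and> stays_in_cone pc pb vb om U y"

definition record_time :: "real \<Rightarrow> real \<Rightarrow> real \<Rightarrow> ((int \<Rightarrow> int) \<Rightarrow> nat) \<Rightarrow> (int \<times> int \<Rightarrow> real) \<Rightarrow> nat \<Rightarrow> enat" where
  "record_time pc pb vb om U k =
     (let P = (\<lambda>n. real_of_int (Xpos pc pb om U (0,0) n) \<ge> (1 - vb) * real k + vb * real n)
      in if \<exists>n. P n then enat (LEAST n. P n) else \<infinity>)"

definition regen_time :: "real \<Rightarrow> real \<Rightarrow> real \<Rightarrow> ((int \<Rightarrow> int) \<Rightarrow> nat) \<Rightarrow> (int \<times> int \<Rightarrow> real) \<Rightarrow> enat" where
  "regen_time pc pb vb om U =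
     (let G = (\<lambda>k. 1 \<le> k \<and> record_time pc pb vb om U k \<noteq> \<infinity> \<and>
                  good_point pc pb vb om U (Ypos pc pb om U (0,0) (the_enat (record_time pc pb vb om U k))))
      in if \<exists>k. G k then record_time pc pb vb om U (LEAST k. G k) else \<infinity>)"

definition traj_space :: "(nat \<Rightarrow> int \<times> int) measure" where
  "traj_space = PiM UNIV (\<lambda>_. count_space UNIV)"

text \<open>(Y_{tau+i} - Y_tau)_{i >= 0}  (meaningful when tau < infinity).\<close>
definition post_regen :: "real \<Rightarrow> real \<Rightarrow> real \<Rightarrow> ((int \<Rightarrow> int) \<Rightarrow> nat) \<Rightarrow> (int \<times> int \<Rightarrow> real) \<Rightarrow> nat \<Rightarrow> int \<times> int" where
  "post_regen pc pb vb om U i =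
     (let t = the_enat (regen_time pc pb vb om U);
          y0 = Ypos pc pb om U (0,0) t; y = Ypos pc pb om U (0,0) (t + i)
      in (fst y - fst y0, snd y - snd y0))"

definition pre_regen :: "real \<Rightarrow> real \<Rightarrow> real \<Rightarrow> ((int \<Rightarrow> int) \<Rightarrow> nat) \<Rightarrow> (int \<times> int \<Rightarrow> real) \<Rightarrow> enat \<times> (nat \<Rightarrow> int \<times> int)" where
  "pre_regen pc pb vb om U =
     (regen_time pc pb vb om U,
      \<lambda>i. if enat i \<le> regen_time pc pb vb om U then Ypos pc pb om U (0,0) i else (0,0))"

definition regen_sigma :: "'a measure \<Rightarrow> real \<Rightarrow> real \<Rightarrow> real \<Rightarrow> ('a \<Rightarrow> (int \<Rightarrow> int) \<Rightarrow> nat) \<Rightarrow> ('a \<Rightarrow> int \<times> int \<Rightarrow> real) \<Rightarrow> 'a measure" where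
  "regen_sigma M pc pb vb om U =
     vimage_algebra (space M) (\<lambda>\<xi>. pre_regen pc pb vb (om \<xi>) (U \<xi>))
       (count_space UNIV \<Otimes>\<^sub>M traj_space)"

definition P_angle :: "'a measure \<Rightarrow> real \<Rightarrow> real \<Rightarrow> real \<Rightarrow> ('a \<Rightarrow> (int \<Rightarrow> int) \<Rightarrow> nat) \<Rightarrow> ('a \<Rightarrow> int \<times> int \<Rightarrow> real) \<Rightarrow> 'a measure" where
  "P_angle M pc pb vb om U =
     uniform_measure M {\<xi> \<in> space M. good_point pc pb vb (om \<xi>) (U \<xi>) (0,0)}"

end

theory Submission
  imports Defs
begin

text \<open>
  At a record \<open>y\<close> of the walk reached at time \<open>n\<close>, the past trajectory lies in the reversed
  cone at \<open>y\<close>, so if no path of the point process crosses both cones at \<open>y\<close>, the past depends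
  only on marks outside the forward cone and on paths avoiding it. The same holds for the failure
  of the earlier records to be good: they lie in the reversed cone, \<open>y\<close> lies in their forward
  cones, and once the walk stays in the cone at \<open>y\<close> whether it leaves an earlier cone is decided
  before time \<open>n\<close>. Whether \<open>y\<close> is good and where the walk goes afterwards depends only on the
  marks in the cone and the paths meeting it. These two parts of the environment are independent
  and the second has a translation invariant law, so the probability that the regeneration occurs
  at time \<open>n\<close> along a given trajectory, with future in \<open>B\<close>, factorizes into a term not involving \<open>B\<close>
  and the probability that the origin is good with trajectory in \<open>B\<close>.

  The \<open>\<sigma>\<close>-algebras are generated by the void events of the point process together with the marks.
  Void events are stable under intersection, so their probabilities \<open>exp (- intensity A)\<close> already
  determine laws and independence.
\<close>

section \<open>The lazy random walk and its intensity measure\<close>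

lemma space_path_space [simp]: "space path_space = UNIV"
  by (simp add: path_space_def space_PiM)

lemma measurable_path_eval [measurable]: "(\<lambda>w. w n) \<in> path_space \<rightarrow>\<^sub>M count_space UNIV"
  unfolding path_space_def by measurable

text \<open>The three weights add up to one, so \<open>embed_pmf\<close> really has them as its mass
  function. The support bound later shows that walk paths have steps of size at most one.\<close>

lemma set_step_pmf:
  assumes "0 < q" "q < 1"
  shows "set_pmf (step_pmf q) \<subseteq> {-1, 0, 1}"
proof -
  let ?f = "\<lambda>k::int. if k = 0 then q else if k = 1 \<or> k = -1 then (1 - q) / 2 else 0"
  have "(\<integral>\<^sup>+ k. ennreal (?f k) \<partial>count_space UNIV) = (\<integral>\<^sup>+ k. ennreal (?f k) \<partial>count_space {-1, 0, 1})"
    by (rule nn_integral_count_space_eq) auto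
  also have "\<dots> = (\<Sum>k\<in>{-1, 0, 1::int}. ennreal (?f k))"
    by (rule nn_integral_count_space_finite) simp
  also have "\<dots> = ennreal (\<Sum>k\<in>{-1, 0, 1::int}. ?f k)"
    using assms by (intro sum_ennreal) auto
  also have "\<dots> = 1"
    by (simp add: field_simps)
  finally have "pmf (step_pmf q) k = ?f k" for k
    using assms unfolding step_pmf_def by (subst pmf_embed_pmf) auto
  then show ?thesis
    by (auto simp: set_pmf_iff split: if_splits)
qed

lemma walk_from_0 [simp]: "walk_from x xi 0 = x"
  by (simp add: walk_from_def)

lemma walk_from_add_1: "walk_from x xi (n + 1) = walk_from x xi n + xi n"
proof (cases "0 \<le> n")
  case True
  then have "{0..<n + 1} = insert n {0..<n}" by auto
  with True show ?thesis by (simp add: walk_from_def)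
next
  case False
  then have *: "{n..<0} = insert n {n + 1..<0}" by auto
  with False have "walk_from x xi n = x - (xi n + (\<Sum>k\<in>{n + 1..<0}. xi k))"
    by (simp add: walk_from_def *)
  moreover have "walk_from x xi (n + 1) = x - (\<Sum>k\<in>{n + 1..<0}. xi k)"
    using False by (cases "n = -1") (simp_all add: walk_from_def)
  ultimately show ?thesis by simp
qed

lemma walk_from_unique:
  assumes "\<And>n. f (n + 1) = f n + xi n"
  shows "f n = walk_from (f 0) xi n"
proof (induction n rule: int_induct[where k = 0])
  case (step2 i)
  from assms[of "i - 1"] walk_from_add_1[of "f 0" xi "i - 1"] step2 show ?case by simp
qed (simp_all add: assms walk_from_add_1)

text \<open>As functions of \<open>n\<close> both sides obey the same two-sided recursion and agree
  at \<open>n = 0\<close>.\<close>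

lemma walk_from_add: "walk_from x xi (n + t) = walk_from (walk_from x xi t) (\<lambda>k. xi (k + t)) n"
proof -
  have "walk_from x xi (n + 1 + t) = walk_from x xi (n + t) + xi (n + t)" for n
    using walk_from_add_1[of x xi "n + t"] by (simp only: ac_simps)
  from walk_from_unique[of "\<lambda>n. walk_from x xi (n + t)", OF this] show ?thesis by simp
qed

lemma walk_from_plus: "walk_from (x + c) xi n = walk_from x xi n + c"
  by (simp add: walk_from_def)

lemma measurable_int_add:
  fixes f g :: "'b \<Rightarrow> int"
  assumes [measurable]: "f \<in> M \<rightarrow>\<^sub>M count_space UNIV" "g \<in> M \<rightarrow>\<^sub>M count_space UNIV"
  shows "(\<lambda>x. f x + g x) \<in> M \<rightarrow>\<^sub>M count_space UNIV"
  by (rule measurable_compose_countable[where g = f and f = "\<lambda>i x. i + g x"]) measurable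

lemma measurable_int_sum:
  fixes f :: "'i \<Rightarrow> 'b \<Rightarrow> int"
  assumes "\<And>i. i \<in> I \<Longrightarrow> f i \<in> M \<rightarrow>\<^sub>M count_space UNIV"
  shows "(\<lambda>x. \<Sum>i\<in>I. f i x) \<in> M \<rightarrow>\<^sub>M count_space UNIV"
  using assms by (induction I rule: infinite_finite_induct) (auto intro!: measurable_int_add)

definition increments :: "real \<Rightarrow> (int \<Rightarrow> int) measure" where
  "increments q = PiM UNIV (\<lambda>_. measure_pmf (step_pmf q))"

lemma space_increments [simp]: "space (increments q) = UNIV"
  by (simp add: increments_def space_PiM)

lemma prob_space_increments: "prob_space (increments q)"
  unfolding increments_def by (intro prob_space_PiM prob_space_measure_pmf)

lemma measurable_increment [measurable]: "(\<lambda>xi. xi n) \<in> increments q \<rightarrow>\<^sub>M count_space UNIV"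
proof -
  have "(\<lambda>xi. xi n) \<in> increments q \<rightarrow>\<^sub>M measure_pmf (step_pmf q)"
    unfolding increments_def by measurable
  then show ?thesis by simp
qed

lemma measurable_walk_from_eval [measurable]:
  "(\<lambda>xi. walk_from x xi n) \<in> increments q \<rightarrow>\<^sub>M count_space UNIV"
proof (cases "0 \<le> n")
  case True
  have "(\<lambda>xi. x + (\<Sum>k\<in>{0..<n}. xi k)) \<in> increments q \<rightarrow>\<^sub>M count_space UNIV"
    by (intro measurable_int_add measurable_int_sum) auto
  with True show ?thesis by (simp add: walk_from_def)
next
  case False
  have "(\<lambda>xi. \<Sum>k\<in>{n..<0}. xi k) \<in> increments q \<rightarrow>\<^sub>M count_space UNIV"
    by (intro measurable_int_sum) auto
  then have "(\<lambda>xi. x - (\<Sum>k\<in>{n..<0}. xi k)) \<in> increments q \<rightarrow>\<^sub>M count_space UNIV"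
    by (rule measurable_compose) auto
  with False show ?thesis by (simp add: walk_from_def)
qed

lemma measurable_walk_from [measurable]: "walk_from x \<in> increments q \<rightarrow>\<^sub>M path_space"
  unfolding path_space_def by (rule measurable_PiM_single') auto

lemma emeasure_lsrw:
  assumes [measurable]: "A \<in> sets path_space"
  shows "emeasure (lsrw q x) A = (\<integral>\<^sup>+ xi. indicator A (walk_from x xi) \<partial>increments q)"
proof -
  have "emeasure (lsrw q x) A = emeasure (increments q) (walk_from x -` A \<inter> space (increments q))"
    unfolding lsrw_def by (fold increments_def) (rule emeasure_distr, auto)
  also have "\<dots> = (\<integral>\<^sup>+ xi. indicator (walk_from x -` A \<inter> space (increments q)) xi \<partial>increments q)"
    by (rule nn_integral_indicator[symmetric]) measurable
  finally show ?thesis by (simp add: indicator_def)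
qed

lemma sets_lsrw: "sets (lsrw q x) = sets path_space"
  by (simp add: lsrw_def)

text \<open>Tonelli moves the sum over starting points inside. For fixed increments a path is
  determined by its starting point, which is summed against counting measure; this is what absorbs
  spatial translations.\<close>

lemma intensity_alt:
  assumes [measurable]: "A \<in> sets path_space"
  shows "intensity \<rho> q A =
    ennreal \<rho> * (\<integral>\<^sup>+ xi. (\<integral>\<^sup>+ x. indicator A (walk_from x xi) \<partial>count_space UNIV) \<partial>increments q)"
proof -
  interpret P: prob_space "increments q" by (rule prob_space_increments)
  interpret C: sigma_finite_measure "count_space (UNIV :: int set)"
    by (rule sigma_finite_measure_count_space)
  interpret pair_sigma_finite "count_space (UNIV :: int set)" "increments q" ..
  have "(\<lambda>(x, xi). indicator A (walk_from x xi) :: ennreal)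
      \<in> borel_measurable (count_space UNIV \<Otimes>\<^sub>M increments q)"
    by (rule measurable_pair_measure_countable1) auto
  from Fubini'[OF this] show ?thesis
    by (simp add: intensity_def emeasure_lsrw)
qed

section \<open>Translations of paths and invariance of the intensity\<close>

definition path_shift :: "int \<times> int \<Rightarrow> (int \<Rightarrow> int) \<Rightarrow> int \<Rightarrow> int" where
  "path_shift y w = (\<lambda>n. w (n + snd y) - fst y)"

lemma measurable_path_shift [measurable]: "path_shift y \<in> path_space \<rightarrow>\<^sub>M path_space"
proof -
  have "(\<lambda>w. w m - fst y) \<in> path_space \<rightarrow>\<^sub>M count_space UNIV" for m
    by (rule measurable_compose[OF measurable_path_eval]) auto
  then show ?thesis
    unfolding path_shift_def by (subst (2) path_space_def) (rule measurable_PiM_single', auto)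
qed

lemma path_shift_vimage_sets:
  assumes "A \<in> sets path_space"
  shows "path_shift y -` A \<in> sets path_space"
  using measurable_sets[OF measurable_path_shift assms, of y] by simp

text \<open>\<open>path_shift y\<close> translates the trace by \<open>- y\<close>. The translated
  walk is again a walk, with time-shifted increments and with its start moved by an amount that
  depends on the increments only.\<close>

lemma path_shift_walk_from:
  "path_shift y (walk_from x xi) =
    walk_from (x + (walk_from 0 xi (snd y) - fst y)) (\<lambda>k. xi (k + snd y))"
  using walk_from_add[of x xi _ "snd y"] walk_from_plus[of 0 x xi "snd y"]
  by (auto simp: path_shift_def fun_eq_iff walk_from_def)

lemma distr_increments_shift: "distr (increments q) (increments q) (\<lambda>xi k. xi (k + t)) = increments q"
  using distr_PiM_reindex[of UNIV "\<lambda>_. measure_pmf (step_pmf q)" "\<lambda>k::int. k + t" UNIV]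
  by (simp add: increments_def prob_space_measure_pmf restrict_UNIV)

text \<open>For fixed increments, moving the starting point is a bijection of the integers, so the
  sum over starting points does not change. The time shift of the increments is harmless because
  they are i.i.d.\<close>

lemma intensity_path_shift:
  assumes [measurable]: "A \<in> sets path_space"
  shows "intensity \<rho> q (path_shift y -` A) = intensity \<rho> q A"
proof -
  let ?g = "\<lambda>xi. \<integral>\<^sup>+ x. indicator A (walk_from x xi) \<partial>count_space UNIV"
  have S: "(\<lambda>xi k. xi (k + snd y)) \<in> increments q \<rightarrow>\<^sub>M increments q"
    by (subst (2) increments_def, rule measurable_PiM_single') auto
  have "(\<integral>\<^sup>+ x. indicator (path_shift y -` A) (walk_from x xi) \<partial>count_space UNIV) = ?g (\<lambda>k. xi (k + snd y))" for xi
  proof -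
    let ?c = "walk_from 0 xi (snd y) - fst y"
    have b: "bij_betw (\<lambda>x. x + ?c) UNIV UNIV"
      by (rule bij_betw_byWitness[where f' = "\<lambda>x. x - ?c"]) auto
    show ?thesis
      by (subst nn_integral_bij_count_space[OF b, symmetric])
        (simp add: path_shift_walk_from indicator_def)
  qed
  then have "intensity \<rho> q (path_shift y -` A) = ennreal \<rho> * (\<integral>\<^sup>+ xi. ?g (\<lambda>k. xi (k + snd y)) \<partial>increments q)"
    using path_shift_vimage_sets[OF assms] by (simp add: intensity_alt)
  also have "(\<integral>\<^sup>+ xi. ?g (\<lambda>k. xi (k + snd y)) \<partial>increments q)
      = (\<integral>\<^sup>+ xi. ?g xi \<partial>distr (increments q) (increments q) (\<lambda>xi k. xi (k + snd y)))"
  proof -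
    interpret C: sigma_finite_measure "count_space (UNIV :: int set)"
      by (rule sigma_finite_measure_count_space)
    have m: "(\<lambda>(x, xi). indicator A (walk_from x xi) :: ennreal)
        \<in> borel_measurable (count_space UNIV \<Otimes>\<^sub>M increments q)"
      by (rule measurable_pair_measure_countable1) auto
    have "(\<lambda>(xi, x). indicator A (walk_from x xi) :: ennreal)
        \<in> borel_measurable (increments q \<Otimes>\<^sub>M count_space UNIV)"
      using measurable_compose[OF measurable_pair_swap' m] by (simp add: split_beta)
    then have "?g \<in> borel_measurable (increments q)"
      by (intro C.borel_measurable_nn_integral) simp
    then show ?thesis by (subst nn_integral_distr[OF S]) simp_all
  qed
  finally show ?thesis
    using assms by (simp add: distr_increments_shift intensity_alt)
qed

lemma intensity_Un_le:
  assumes "A \<in> sets path_space" "B \<in> sets path_space"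
  shows "intensity \<rho> q (A \<union> B) \<le> intensity \<rho> q A + intensity \<rho> q B"
  using assms unfolding intensity_def
  by (auto simp: distrib_left[symmetric] nn_integral_add[symmetric] sets_lsrw
      intro!: mult_left_mono nn_integral_mono emeasure_subadditive)

lemma intensity_Un_disjoint:
  assumes "A \<in> sets path_space" "B \<in> sets path_space" "A \<inter> B = {}"
  shows "intensity \<rho> q (A \<union> B) = intensity \<rho> q A + intensity \<rho> q B"
  using assms unfolding intensity_def
  by (simp add: distrib_left[symmetric] nn_integral_add[symmetric] sets_lsrw plus_emeasure)

lemma intensity_mono:
  assumes "A \<subseteq> B" "B \<in> sets path_space"
  shows "intensity \<rho> q A \<le> intensity \<rho> q B"
  using assms unfolding intensity_def
  by (intro mult_left_mono nn_integral_mono emeasure_mono) (auto simp: sets_lsrw)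

definition through :: "int \<times> int \<Rightarrow> (int \<Rightarrow> int) set" where
  "through z = {w. w (snd z) = fst z}"

lemma sets_through [measurable]: "through z \<in> sets path_space"
proof -
  have "{w \<in> space path_space. w (snd z) = fst z} \<in> sets path_space" by measurable
  then show ?thesis by (simp add: through_def)
qed

text \<open>At time 0 the walk is at its starting point, so for any increments exactly one start
  contributes. The sets \<open>through (x, 0)\<close> thus cut path space into countably many pieces
  of finite intensity.\<close>

lemma intensity_through_0: "intensity \<rho> q (through (x, 0)) < \<infinity>"
proof -
  have "(\<integral>\<^sup>+ x'. indicator (through (x, 0)) (walk_from x' xi) \<partial>count_space UNIV)
      = (\<integral>\<^sup>+ x'. indicator {x} x' \<partial>count_space (UNIV :: int set))" for xi
    by (auto simp: through_def indicator_def intro!: nn_integral_cong)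
  then have "intensity \<rho> q (through (x, 0)) = ennreal \<rho> * emeasure (increments q) UNIV"
    by (simp add: intensity_alt)
  also have "\<dots> < \<infinity>"
    using prob_space.emeasure_space_1[OF prob_space_increments[of q]] by simp
  finally show ?thesis .
qed

lemma sets_Wpaths [measurable]: "Wpaths \<in> sets path_space"
proof -
  have "(\<lambda>w. w (n + 1) - w n) \<in> path_space \<rightarrow>\<^sub>M count_space UNIV" for n
    using measurable_int_add[OF measurable_path_eval[of "n + 1"]
        measurable_compose[OF measurable_path_eval[of n], of uminus "count_space UNIV"]] by simp
  note [measurable] = measurable_compose[OF this, of "\<lambda>k. \<bar>k\<bar> \<le> 1" "count_space UNIV"]
  have "{w \<in> space path_space. \<forall>n. \<bar>w (n + 1) - w n\<bar> \<le> 1} \<in> sets path_space"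
    by measurable
  then show ?thesis by (simp add: Wpaths_def)
qed

text \<open>Almost surely all increments lie in {-1, 0, 1}. Configurations are defined on all
  functions, so that their points lie in \<open>Wpaths\<close> has to come from this null
  intensity.\<close>

lemma intensity_Compl_Wpaths:
  assumes "0 < q" "q < 1"
  shows "intensity \<rho> q (- Wpaths) = 0"
proof -
  have "AE xi in increments q. \<bar>xi n\<bar> \<le> 1" for n :: int
    unfolding increments_def
  proof (rule AE_PiM_component)
    show "AE k in measure_pmf (step_pmf q). \<bar>k\<bar> \<le> 1"
      using set_step_pmf[OF assms] by (auto simp: AE_measure_pmf_iff)
  qed (auto simp: prob_space_measure_pmf)
  then have "AE xi in increments q. \<forall>n. \<bar>xi n\<bar> \<le> 1"
    by (simp add: AE_all_countable)
  then have "AE xi in increments q. indicator (- Wpaths) (walk_from x xi) = (0 :: ennreal)" for x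
    by eventually_elim (auto simp: Wpaths_def walk_from_add_1)
  then have "emeasure (lsrw q x) (- Wpaths) = 0" for x
    using sets.compl_sets[OF sets_Wpaths]
    by (subst emeasure_lsrw) (auto simp: nn_integral_0_iff_AE Compl_eq_Diff_UNIV)
  then show ?thesis by (simp add: intensity_def)
qed

section \<open>The environment and its law\<close>

type_synonym env = "((int \<Rightarrow> int) \<Rightarrow> nat) \<times> (int \<times> int \<Rightarrow> real)"

lemma count_in_eq_0_iff: "count_in m A = 0 \<longleftrightarrow> (\<forall>w\<in>A. m w = 0)"
  by (simp add: count_in_def nn_integral_0_iff_AE AE_count_space)

definition env_event :: "(int \<Rightarrow> int) set \<Rightarrow> (int \<times> int) set \<Rightarrow> (int \<times> int \<Rightarrow> real set) \<Rightarrow> env set" where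
  "env_event A J S = {e. (\<forall>w\<in>A. fst e w = 0) \<and> (\<forall>z\<in>J. snd e z \<in> S z)}"

text \<open>\<open>G\<close> and \<open>R\<close> are the paths and the sites that may be inspected.
  Finite intensity is required because the model prescribes void probabilities only in that
  case.\<close>

definition env_gen :: "real \<Rightarrow> real \<Rightarrow> (int \<Rightarrow> int) set \<Rightarrow> (int \<times> int) set \<Rightarrow> env set set" where
  "env_gen \<rho> q G R = {env_event A J S | A J S. A \<in> sets path_space \<and> A \<subseteq> G \<and>
     intensity \<rho> q A < \<infinity> \<and> finite J \<and> J \<subseteq> R \<and> (\<forall>z. S z \<in> sets borel)}"

text \<open>The information carried by \<open>G\<close> and \<open>R\<close>. Multiplicities are
  seen only through voids, which suffices because occupation and goodness depend on the
  configuration only through them.\<close>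

definition env_space :: "real \<Rightarrow> real \<Rightarrow> (int \<Rightarrow> int) set \<Rightarrow> (int \<times> int) set \<Rightarrow> env measure" where
  "env_space \<rho> q G R = sigma UNIV (env_gen \<rho> q G R)"

lemma space_env_space [simp]: "space (env_space \<rho> q G R) = UNIV"
  by (simp add: env_space_def space_measure_of_conv)

lemma UNIV_in_sets_env_space [simp]: "UNIV \<in> sets (env_space \<rho> q G R)"
  using sets.top[of "env_space \<rho> q G R"] by simp

lemma sets_env_space: "sets (env_space \<rho> q G R) = sigma_sets UNIV (env_gen \<rho> q G R)"
  by (simp add: env_space_def sets_measure_of_conv)

lemma env_eventI:
  assumes "A \<in> sets path_space" "A \<subseteq> G" "intensity \<rho> q A < \<infinity>" "finite J" "J \<subseteq> R"
    "\<And>z. S z \<in> sets borel"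
  shows "env_event A J S \<in> env_gen \<rho> q G R"
  using assms unfolding env_gen_def by blast

lemma env_genE:
  assumes "X \<in> env_gen \<rho> q G R"
  obtains A J S where "X = env_event A J S" "A \<in> sets path_space" "A \<subseteq> G"
    "intensity \<rho> q A < \<infinity>" "finite J" "J \<subseteq> R" "\<And>z. S z \<in> sets borel"
  using assms unfolding env_gen_def by blast

lemma env_event_in_sets:
  assumes "A \<in> sets path_space" "A \<subseteq> G" "intensity \<rho> q A < \<infinity>" "finite J" "J \<subseteq> R"
    "\<And>z. S z \<in> sets borel"
  shows "env_event A J S \<in> sets (env_space \<rho> q G R)"
  unfolding sets_env_space by (intro sigma_sets.Basic env_eventI assms)

lemma env_gen_subset_sets: "env_gen \<rho> q G R \<subseteq> sets (env_space \<rho> q G R)"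
  unfolding sets_env_space by (rule sigma_sets_superset_generator)

text \<open>Sites constrained by only one of the two events are padded with \<open>UNIV\<close>, so
  that the intersection has the same form.\<close>

lemma env_event_Int:
  "env_event A J S \<inter> env_event A' J' S' = env_event (A \<union> A') (J \<union> J')
     (\<lambda>z. (if z \<in> J then S z else UNIV) \<inter> (if z \<in> J' then S' z else UNIV))"
  by (auto simp: env_event_def)

lemma intensity_Un_finite:
  assumes "A \<in> sets path_space" "B \<in> sets path_space"
    and "intensity \<rho> q A < \<infinity>" "intensity \<rho> q B < \<infinity>"
  shows "intensity \<rho> q (A \<union> B) < \<infinity>"
  by (rule le_less_trans[OF intensity_Un_le]) (use assms in simp_all)

lemma intensity_empty [simp]: "intensity \<rho> q {} = 0"
  by (simp add: intensity_def)

lemma Int_stable_env_gen: "Int_stable (env_gen \<rho> q G R)"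
proof (rule Int_stableI)
  fix X Y assume "X \<in> env_gen \<rho> q G R" "Y \<in> env_gen \<rho> q G R"
  then show "X \<inter> Y \<in> env_gen \<rho> q G R"
    by (elim env_genE, simp only: env_event_Int, intro env_eventI intensity_Un_finite) auto
qed

text \<open>The set \<open>A\<close> may have infinite intensity, so its void event need not be a
  generator. Its slices by the position at time 0 have finite intensity, and there are countably
  many of them.\<close>

lemma void_in_sets_env_space:
  assumes A: "A \<in> sets path_space" "A \<subseteq> G"
  shows "{e. \<forall>w\<in>A. fst e w = 0} \<in> sets (env_space \<rho> q G R)"
proof -
  have "{e :: env. \<forall>w\<in>A. fst e w = 0} = (\<Inter>x::int. env_event (A \<inter> through (x, 0)) {} (\<lambda>_. UNIV))"
    by (auto simp: env_event_def through_def)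
  also have "\<dots> \<in> sets (env_space \<rho> q G R)"
  proof (intro sets.countable_INT'' env_event_in_sets)
    show "intensity \<rho> q (A \<inter> through (x, 0)) < \<infinity>" for x
      using intensity_mono[of "A \<inter> through (x, 0)" "through (x, 0)" \<rho> q] intensity_through_0[of \<rho> q x]
      by (auto intro: le_less_trans)
  qed (use A in \<open>auto intro: sets.Int\<close>)
  finally show ?thesis .
qed

lemma measurable_mark:
  assumes "z \<in> R"
  shows "(\<lambda>e. snd e z) \<in> borel_measurable (env_space \<rho> q G R)"
proof (rule measurableI)
  fix S :: "real set" assume "S \<in> sets borel"
  then have "env_event {} {z} (\<lambda>_. S) \<in> sets (env_space \<rho> q G R)"
    using assms by (intro env_event_in_sets) auto
  then show "(\<lambda>e. snd e z) -` S \<inter> space (env_space \<rho> q G R) \<in> sets (env_space \<rho> q G R)"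
    by (simp add: env_event_def vimage_def)
qed simp

lemma sets_env_space_mono:
  assumes "G \<subseteq> G'" "R \<subseteq> R'"
  shows "sets (env_space \<rho> q G R) \<subseteq> sets (env_space \<rho> q G' R')"
  unfolding sets_env_space
  by (rule sigma_sets_mono') (use assms in \<open>auto simp: env_gen_def\<close>, blast)

section \<open>Translation and thinning of environments\<close>

definition env_shift :: "int \<times> int \<Rightarrow> env \<Rightarrow> env" where
  "env_shift y e = (\<lambda>w. fst e (path_shift (- y) w), \<lambda>z. snd e (z + y))"

lemma path_shift_inverse [simp]:
  "path_shift y (path_shift (- y) w) = w" "path_shift (- y) (path_shift y w) = w"
  by (simp_all add: path_shift_def)

text \<open>Composing the multiplicity function with \<open>path_shift (- y)\<close> moves the
  points of the configuration by \<open>path_shift y\<close>, hence the preimage on the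
  right.\<close>

lemma env_shift_void: "(\<forall>w\<in>A. fst (env_shift y e) w = 0) \<longleftrightarrow> (\<forall>w\<in>path_shift y -` A. fst e w = 0)"
  unfolding env_shift_def by (metis fst_conv path_shift_inverse vimage_eq)

lemma env_shift_vimage:
  "env_shift y -` env_event A J S = env_event (path_shift y -` A) ((\<lambda>z. z + y) ` J) (\<lambda>z. S (z - y))"
  unfolding env_event_def vimage_def mem_Collect_eq env_shift_void
  by (auto simp: env_shift_def)

text \<open>Preimages of generators are generators: invariance of the intensity keeps it
  finite.\<close>

lemma measurable_env_shift:
  "env_shift y \<in> env_space \<rho> q UNIV UNIV \<rightarrow>\<^sub>M env_space \<rho> q UNIV UNIV"
proof (rule measurable_sigma_sets[OF sets_env_space])
  fix X assume "X \<in> env_gen \<rho> q UNIV UNIV"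
  then obtain A J S where X: "X = env_event A J S" and *: "A \<in> sets path_space" "A \<subseteq> UNIV"
    "intensity \<rho> q A < \<infinity>" "finite J" "J \<subseteq> UNIV" "\<And>z. S z \<in> sets borel"
    unfolding env_gen_def by blast
  then have "env_event (path_shift y -` A) ((\<lambda>z. z + y) ` J) (\<lambda>z. S (z - y))
      \<in> sets (env_space \<rho> q UNIV UNIV)"
    by (intro env_event_in_sets path_shift_vimage_sets) (simp_all only: intensity_path_shift, simp_all)
  then show "env_shift y -` X \<inter> space (env_space \<rho> q UNIV UNIV) \<in> sets (env_space \<rho> q UNIV UNIV)"
    by (simp add: X env_shift_vimage)
qed auto

definition thin :: "(int \<Rightarrow> int) set \<Rightarrow> env \<Rightarrow> env" where
  "thin G e = (\<lambda>w. if w \<in> G then fst e w else 0, snd e)"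

text \<open>A void of \<open>A\<close> after thinning is a void of \<open>A \<inter> G\<close>
  before. Hence an event described with all paths of the thinned environment uses only the paths in
  \<open>G\<close>.\<close>

lemma measurable_thin:
  assumes "G \<in> sets path_space"
  shows "thin G \<in> env_space \<rho> q G R \<rightarrow>\<^sub>M env_space \<rho> q UNIV R"
proof (rule measurable_sigma_sets[OF sets_env_space])
  fix X assume "X \<in> env_gen \<rho> q UNIV R"
  then obtain A J S where X: "X = env_event A J S" and *: "A \<in> sets path_space" "A \<subseteq> UNIV"
    "intensity \<rho> q A < \<infinity>" "finite J" "J \<subseteq> R" "\<And>z. S z \<in> sets borel"
    unfolding env_gen_def by blast
  have "thin G -` X = env_event (A \<inter> G) J S"
    by (auto simp: X env_event_def thin_def)
  moreover have "env_event (A \<inter> G) J S \<in> sets (env_space \<rho> q G R)"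
    using * assms intensity_mono[of "A \<inter> G" A \<rho> q]
    by (intro env_event_in_sets) (auto intro: le_less_trans)
  ultimately show "thin G -` X \<inter> space (env_space \<rho> q G R) \<in> sets (env_space \<rho> q G R)"
    by simp
qed auto

text \<open>Stationarity and independence use only that all marks share one law, so the uniform
  distribution stays folded in this name.\<close>

definition mark_prob :: "real set \<Rightarrow> real" where
  "mark_prob = measure (uniform_measure lborel {0..1})"

section \<open>Void probabilities, stationarity and independence of the environment\<close>

locale rw_environment = prob_space M
  for M :: "'a measure" +
  fixes om :: "'a \<Rightarrow> (int \<Rightarrow> int) \<Rightarrow> nat" and U :: "'a \<Rightarrow> int \<times> int \<Rightarrow> real" and \<rho> q :: real
  assumes model: "rw_model M om U \<rho> q" and q: "0 < q" "q < 1"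
begin

abbreviation env :: "'a \<Rightarrow> env" where "env \<xi> \<equiv> (om \<xi>, U \<xi>)"

lemma count_measurable [measurable]:
  "A \<in> sets path_space \<Longrightarrow> (\<lambda>\<xi>. count_in (om \<xi>) A) \<in> borel_measurable M"
  using model by (simp add: rw_model_def)

lemma indep_marks: "indep_vars (\<lambda>_. borel) (\<lambda>y \<xi>. U \<xi> y) UNIV"
  using model unfolding rw_model_def by blast

lemma mark_measurable [measurable]: "(\<lambda>\<xi>. U \<xi> z) \<in> borel_measurable M"
  using indep_marks unfolding indep_vars_def by blast

lemma prob_void:
  assumes "A \<in> sets path_space" "intensity \<rho> q A < \<infinity>"
  shows "prob {\<xi> \<in> space M. count_in (om \<xi>) A = 0} = exp (- enn2real (intensity \<rho> q A))"
proof -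
  have "prob {\<xi> \<in> space M. count_in (om \<xi>) A = of_nat 0}
      = exp (- enn2real (intensity \<rho> q A)) * enn2real (intensity \<rho> q A) ^ 0 / fact 0"
    using model assms unfolding rw_model_def by blast
  then show ?thesis by simp
qed

lemma prob_mark:
  assumes "S \<in> sets borel"
  shows "prob {\<xi> \<in> space M. U \<xi> z \<in> S} = mark_prob S"
proof -
  have "distr M borel (\<lambda>\<xi>. U \<xi> z) = uniform_measure lborel {0..1}"
    using model unfolding rw_model_def by blast
  then show ?thesis
    using measure_distr[OF mark_measurable assms, of z] by (simp add: mark_prob_def vimage_def Int_def conj_commute)
qed

lemma prob_marks:
  assumes "finite J" "\<And>z. S z \<in> sets borel"
  shows "prob {\<xi> \<in> space M. \<forall>z\<in>J. U \<xi> z \<in> S z}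
    = (\<Prod>z\<in>J. mark_prob (S z))"
\<comment> \<open>The product rule for \<open>indep_vars\<close> is stated for nonempty index sets;
  for empty \<open>J\<close> both sides are one.\<close>
proof (cases "J = {}")
  case False
  have "prob (\<Inter>z\<in>J. (\<lambda>\<xi>. U \<xi> z) -` S z \<inter> space M) = (\<Prod>z\<in>J. prob ((\<lambda>\<xi>. U \<xi> z) -` S z \<inter> space M))"
    using assms by (intro indep_varsD[OF indep_marks False]) auto
  moreover have "(\<Inter>z\<in>J. (\<lambda>\<xi>. U \<xi> z) -` S z \<inter> space M) = {\<xi> \<in> space M. \<forall>z\<in>J. U \<xi> z \<in> S z}"
    using False by auto
  moreover have "(\<lambda>\<xi>. U \<xi> z) -` S z \<inter> space M = {\<xi> \<in> space M. U \<xi> z \<in> S z}" for z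
    by auto
  ultimately show ?thesis
    using assms by (simp add: prob_mark)
qed (simp add: prob_space)

lemma prob_void_marks:
  assumes A: "A \<in> sets path_space" "intensity \<rho> q A < \<infinity>" and J: "finite J" "\<And>z. S z \<in> sets borel"
  shows "prob (env -` env_event A J S \<inter> space M)
    = exp (- enn2real (intensity \<rho> q A)) * (\<Prod>z\<in>J. mark_prob (S z))"
proof -
  let ?GO = "{(\<lambda>\<xi>. count_in (om \<xi>) A) -` S \<inter> space M | A S. A \<in> sets path_space \<and> S \<in> sets (borel :: ennreal measure)}"
  let ?GU = "{(\<lambda>\<xi>. U \<xi> y) -` S \<inter> space M | y S. S \<in> sets borel}"
  let ?V = "{\<xi> \<in> space M. count_in (om \<xi>) A = 0}"
  let ?W = "{\<xi> \<in> space M. \<forall>z\<in>J. U \<xi> z \<in> S z}"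
  have "(\<lambda>\<xi>. count_in (om \<xi>) A) -` {0} \<inter> space M = ?V" by auto
  moreover have "(\<lambda>\<xi>. count_in (om \<xi>) A) -` {0} \<inter> space M \<in> sigma_sets (space M) ?GO"
    using A(1) closed_singleton[of "0 :: ennreal", THEN borel_closed]
    by (intro sigma_sets.Basic CollectI exI[of _ A] exI[of _ "{0}"] conjI refl)
  ultimately have V: "?V \<in> sigma_sets (space M) ?GO" by simp
  \<comment> \<open>Membership in the \<sigma>-algebra of the marks is obtained as measurability in
    a space that carries exactly this \<sigma>-algebra.\<close>
  let ?N = "sigma (space M) ?GU"
  have N: "sets ?N = sigma_sets (space M) ?GU" "space ?N = space M"
    by (rule sets_measure_of space_measure_of, blast)+
  have mark: "(\<lambda>\<xi>. U \<xi> z) \<in> borel_measurable ?N" for z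
  proof (rule measurableI)
    fix T :: "real set" assume "T \<in> sets borel"
    then show "(\<lambda>\<xi>. U \<xi> z) -` T \<inter> space ?N \<in> sets ?N"
      unfolding N by (intro sigma_sets.Basic CollectI exI[of _ z] exI[of _ T] conjI refl)
  qed simp
  have "{\<xi> \<in> space ?N. \<forall>z\<in>J. U \<xi> z \<in> S z} \<in> sets ?N"
  proof (intro sets.sets_Collect_finite_All J)
    fix z
    have "{\<xi> \<in> space ?N. U \<xi> z \<in> S z} = (\<lambda>\<xi>. U \<xi> z) -` S z \<inter> space ?N"
      by blast
    then show "{\<xi> \<in> space ?N. U \<xi> z \<in> S z} \<in> sets ?N"
      using measurable_sets[OF mark J(2)] by (simp only:)
  qed
  then have W: "?W \<in> sigma_sets (space M) ?GU"
    by (simp only: N)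
  have "indep_set (sigma_sets (space M) ?GO) (sigma_sets (space M) ?GU)"
    using model unfolding rw_model_def by blast
  from indep_setD[OF this V W] have "prob (?V \<inter> ?W) = prob ?V * prob ?W" .
  moreover have "env -` env_event A J S \<inter> space M = ?V \<inter> ?W"
    by (auto simp: env_event_def count_in_eq_0_iff)
  ultimately show ?thesis
    using assms by (simp add: prob_void prob_marks)
qed

lemma env_measurable [measurable]: "env \<in> M \<rightarrow>\<^sub>M env_space \<rho> q UNIV UNIV"
proof (rule measurable_sigma_sets[OF sets_env_space])
  fix X assume "X \<in> env_gen \<rho> q UNIV UNIV"
  then obtain A J S where X: "X = env_event A J S" and [measurable]: "A \<in> sets path_space" and "A \<subseteq> UNIV"
    "intensity \<rho> q A < \<infinity>" and [simp]: "finite J" and "J \<subseteq> UNIV" and [measurable]: "\<And>z. S z \<in> sets borel"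
    unfolding env_gen_def by blast
  have "{\<xi> \<in> space M. count_in (om \<xi>) A = 0} \<inter> {\<xi> \<in> space M. \<forall>z\<in>J. U \<xi> z \<in> S z} \<in> sets M"
    by (intro sets.Int sets.sets_Collect_finite_All) measurable
  moreover have "env -` X \<inter> space M
      = {\<xi> \<in> space M. count_in (om \<xi>) A = 0} \<inter> {\<xi> \<in> space M. \<forall>z\<in>J. U \<xi> z \<in> S z}"
    by (auto simp: X env_event_def count_in_eq_0_iff)
  ultimately show "env -` X \<inter> space M \<in> sets M" by simp
qed auto

definition env_law :: "env measure" where
  "env_law = distr M (env_space \<rho> q UNIV UNIV) env"

lemma space_env_law [simp]: "space env_law = UNIV"
  and sets_env_law [simp, measurable_cong]: "sets env_law = sets (env_space \<rho> q UNIV UNIV)"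
  by (simp_all add: env_law_def)

lemma measure_env_law:
  "X \<in> sets (env_space \<rho> q UNIV UNIV) \<Longrightarrow> measure env_law X = prob {\<xi> \<in> space M. env \<xi> \<in> X}"
  unfolding env_law_def by (subst measure_distr) (auto intro!: arg_cong[where f = prob])

lemma env_law_event:
  assumes "A \<in> sets path_space" "intensity \<rho> q A < \<infinity>" "finite J" "\<And>z. S z \<in> sets borel"
  shows "measure env_law (env_event A J S)
    = exp (- enn2real (intensity \<rho> q A)) * (\<Prod>z\<in>J. mark_prob (S z))"
  unfolding env_law_def
  by (subst measure_distr[OF env_measurable])
    (intro env_event_in_sets assms subset_UNIV prob_void_marks)+

sublocale law: prob_space env_law
  unfolding env_law_def by (rule prob_space_distr) measurable

text \<open>Both sides are probability measures, so agreement on the \<open>Int_stable\<close>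
  generators is enough. There the law depends only on the intensity, which is invariant, and on a
  product over marks, which is reindexed.\<close>

lemma env_law_shift: "distr env_law (env_space \<rho> q UNIV UNIV) (env_shift y) = env_law"
proof -
  have *[measurable]: "env_shift y \<in> env_law \<rightarrow>\<^sub>M env_space \<rho> q UNIV UNIV"
    using measurable_env_shift by (simp cong: measurable_cong_sets)
  interpret D: prob_space "distr env_law (env_space \<rho> q UNIV UNIV) (env_shift y)"
    by (rule law.prob_space_distr) measurable
  have eq: "emeasure (distr env_law (env_space \<rho> q UNIV UNIV) (env_shift y)) X = emeasure env_law X"
    if X: "X \<in> env_gen \<rho> q UNIV UNIV" for X
  proof -
    from X obtain A J S where X_eq: "X = env_event A J S" and A: "A \<in> sets path_space" "A \<subseteq> UNIV"
      "intensity \<rho> q A < \<infinity>" "finite J" "J \<subseteq> UNIV" "\<And>z. S z \<in> sets borel"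
      unfolding env_gen_def by blast
    have "measure (distr env_law (env_space \<rho> q UNIV UNIV) (env_shift y)) X
        = measure env_law (env_event (path_shift y -` A) ((\<lambda>z. z + y) ` J) (\<lambda>z. S (z - y)))"
      using X by (subst measure_distr[OF *])
        (auto simp: X_eq env_shift_vimage sets_env_space intro: sigma_sets.Basic)
    also have "\<dots> = measure env_law X"
    proof -
      have "measure env_law (env_event (path_shift y -` A) ((\<lambda>z. z + y) ` J) (\<lambda>z. S (z - y)))
        = exp (- enn2real (intensity \<rho> q A)) *
          (\<Prod>z\<in>(\<lambda>z. z + y) ` J. mark_prob (S (z - y)))"
        using A by (subst env_law_event) (simp_all only: intensity_path_shift path_shift_vimage_sets finite_imageI)
      also have "\<dots> = measure env_law X"
        using A by (simp add: X_eq env_law_event prod.reindex inj_on_def)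
      finally show ?thesis .
    qed
    finally show ?thesis
      by (simp add: D.emeasure_eq_measure law.emeasure_eq_measure)
  qed
  \<comment> \<open>The whole space is the generator without constraints; it serves as the
    exhausting sequence in the uniqueness theorem for measures.\<close>
  have UNIV: "UNIV \<in> env_gen \<rho> q UNIV UNIV"
    using env_eventI[of "{}" UNIV \<rho> q "{}" UNIV "\<lambda>_. UNIV"] by (simp add: env_event_def)
  show ?thesis
  proof (rule measure_eqI_generator_eq)
    show "Int_stable (env_gen \<rho> q UNIV UNIV)" by (rule Int_stable_env_gen)
    show "env_gen \<rho> q UNIV UNIV \<subseteq> Pow UNIV" by simp
    show "sets (distr env_law (env_space \<rho> q UNIV UNIV) (env_shift y)) = sigma_sets UNIV (env_gen \<rho> q UNIV UNIV)"
      "sets env_law = sigma_sets UNIV (env_gen \<rho> q UNIV UNIV)"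
      by (simp_all add: sets_env_space)
    show "range (\<lambda>_::nat. UNIV) \<subseteq> env_gen \<rho> q UNIV UNIV"
      using UNIV by (simp add: image_subset_iff)
    show "emeasure (distr env_law (env_space \<rho> q UNIV UNIV) (env_shift y)) UNIV \<noteq> \<infinity>" for i :: nat
      using D.emeasure_finite[of UNIV] unfolding infinity_ennreal_def .
    show "(\<Union>i::nat. UNIV) = (UNIV :: env set)" by simp
    fix X assume "X \<in> env_gen \<rho> q UNIV UNIV"
    then show "emeasure (distr env_law (env_space \<rho> q UNIV UNIV) (env_shift y)) X = emeasure env_law X"
      by (rule eq)
  qed
qed

text \<open>On generators the path sets are disjoint and so are the site sets: intensities add,
  exponentials multiply and the product over marks splits. Stability under intersection carries this
  over to the \<sigma>-algebras.\<close>

lemma env_law_indep: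
  assumes "F \<in> sets (env_space \<rho> q G R)" "B \<in> sets (env_space \<rho> q (- G) (- R))"
  shows "measure env_law (F \<inter> B) = measure env_law F * measure env_law B"
proof -
  have "law.indep_set (env_gen \<rho> q G R) (env_gen \<rho> q (- G) (- R))"
  proof (rule law.indep_setI)
    show "env_gen \<rho> q G R \<subseteq> law.events" "env_gen \<rho> q (- G) (- R) \<subseteq> law.events"
      using env_gen_subset_sets sets_env_space_mono[OF subset_UNIV subset_UNIV]
      unfolding sets_env_law by (blast intro: order_trans)+
    fix a b assume "a \<in> env_gen \<rho> q G R" "b \<in> env_gen \<rho> q (- G) (- R)"
    then obtain A J S A' J' S' where
      a: "a = env_event A J S" "A \<in> sets path_space" "A \<subseteq> G"
      "intensity \<rho> q A < \<infinity>" "finite J" "J \<subseteq> R" "\<And>z. S z \<in> sets borel" and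
      b: "b = env_event A' J' S'" "A' \<in> sets path_space" "A' \<subseteq> - G"
      "intensity \<rho> q A' < \<infinity>" "finite J'" "J' \<subseteq> - R" "\<And>z. S' z \<in> sets borel"
      unfolding env_gen_def by blast
    let ?S = "\<lambda>z. (if z \<in> J then S z else UNIV) \<inter> (if z \<in> J' then S' z else UNIV)"
    have disj: "A \<inter> A' = {}" "J \<inter> J' = {}" using a b by auto
    have "(\<Prod>z\<in>J \<union> J'. mark_prob (?S z))
        = (\<Prod>z\<in>J. mark_prob (S z)) *
          (\<Prod>z\<in>J'. mark_prob (S' z))"
      using disj a b by (subst prod.union_disjoint)
        (auto intro!: arg_cong2[where f = "(*)"] prod.cong arg_cong[where f = mark_prob])
    moreover have "enn2real (intensity \<rho> q (A \<union> A'))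
        = enn2real (intensity \<rho> q A) + enn2real (intensity \<rho> q A')"
      using a b disj by (simp add: intensity_Un_disjoint enn2real_plus)
    moreover have "law.prob (env_event (A \<union> A') (J \<union> J') ?S)
        = exp (- enn2real (intensity \<rho> q (A \<union> A'))) * (\<Prod>z\<in>J \<union> J'. mark_prob (?S z))"
      using a b by (intro env_law_event sets.Un intensity_Un_finite finite_UnI sets.Int) simp_all
    ultimately show "law.prob (a \<inter> b) = law.prob a * law.prob b"
      unfolding a(1) b(1) env_event_Int env_law_event[OF a(2,4,5,7)] env_law_event[OF b(2,4,5,7)]
      by (simp add: exp_diff exp_minus field_simps)
  qed
  from law.indep_set_sigma_sets[OF this Int_stable_env_gen Int_stable_env_gen] assms
  show ?thesis
    by (intro law.indep_setD) (simp_all add: sets_env_space)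
qed

text \<open>A single void event of intensity zero rules out the uncountably many functions off
  \<open>Wpaths\<close> at once; its probability is \<open>exp 0\<close>.\<close>

lemma AE_env_law_Wpaths: "AE e in env_law. \<forall>w. w \<notin> Wpaths \<longrightarrow> fst e w = 0"
proof -
  let ?X = "env_event (- Wpaths) {} (\<lambda>_. UNIV)"
  have W: "- Wpaths \<in> sets path_space"
    using sets.compl_sets[OF sets_Wpaths] by (simp add: Compl_eq_Diff_UNIV)
  then have "law.prob ?X = 1"
    using env_law_event[OF W, of "{}" "\<lambda>_. UNIV"] by (simp add: intensity_Compl_Wpaths q)
  moreover have "?X \<in> law.events"
    using W by (simp add: env_event_in_sets intensity_Compl_Wpaths q)
  ultimately have "AE e in env_law. e \<in> ?X"
    by (simp add: law.prob_eq_1)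
  then show ?thesis
    by eventually_elim (auto simp: env_event_def)
qed

end

section \<open>Cones, records and regeneration\<close>

lemma cone_iff: "z \<in> cone v y \<longleftrightarrow> fst y \<le> fst z \<and> snd y \<le> snd z \<and>
    v * real_of_int (snd z - snd y) \<le> real_of_int (fst z - fst y)"
proof
  assume "z \<in> cone v y" then show "fst y \<le> fst z \<and> snd y \<le> snd z \<and>
    v * real_of_int (snd z - snd y) \<le> real_of_int (fst z - fst y)"
    by (auto simp: cone_def)
next
  assume "fst y \<le> fst z \<and> snd y \<le> snd z \<and> v * real_of_int (snd z - snd y) \<le> real_of_int (fst z - fst y)"
  then show "z \<in> cone v y"
    unfolding cone_def by (intro CollectI exI[of _ "fst z - fst y"] exI[of _ "snd z - snd y"]) auto
qed

lemma cone_rev_iff: "z \<in> cone_rev v y \<longleftrightarrow> fst z \<le> fst y \<and> snd z \<le> snd y \<and>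
    real_of_int (fst z - fst y) < v * real_of_int (snd z - snd y)"
proof
  assume "z \<in> cone_rev v y" then show "fst z \<le> fst y \<and> snd z \<le> snd y \<and>
    real_of_int (fst z - fst y) < v * real_of_int (snd z - snd y)"
    by (auto simp: cone_rev_def)
next
  assume "fst z \<le> fst y \<and> snd z \<le> snd y \<and> real_of_int (fst z - fst y) < v * real_of_int (snd z - snd y)"
  then show "z \<in> cone_rev v y"
    unfolding cone_rev_def by (intro CollectI exI[of _ "fst z - fst y"] exI[of _ "snd z - snd y"]) auto
qed

lemma cone_trans: "y \<in> cone v x \<Longrightarrow> z \<in> cone v y \<Longrightarrow> z \<in> cone v x"
  by (auto simp: cone_iff algebra_simps)

lemma cone_rev_trans: "y \<in> cone_rev v x \<Longrightarrow> z \<in> cone_rev v y \<Longrightarrow> z \<in> cone_rev v x"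
  by (auto simp: cone_rev_iff algebra_simps)

lemma cone_rev_disjoint: "z \<in> cone_rev v y \<Longrightarrow> z \<notin> cone v y"
  by (auto simp: cone_iff cone_rev_iff)

lemma cone_translate: "z + y \<in> cone v y \<longleftrightarrow> z \<in> cone v 0"
  and cone_rev_translate: "z + y \<in> cone_rev v y \<longleftrightarrow> z \<in> cone_rev v 0"
  by (simp_all add: cone_iff cone_rev_iff)

text \<open>Written as a union over sites, of which there are countably many, so that it is
  measurable.\<close>

definition hits :: "(int \<times> int) set \<Rightarrow> (int \<Rightarrow> int) set" where
  "hits C = (\<Union>z\<in>C. through z)"

lemma sets_hits [measurable]: "hits C \<in> sets path_space"
  unfolding hits_def by (intro sets.countable_UN') auto

lemma hits_iff: "w \<in> hits C \<longleftrightarrow> path_trace w \<inter> C \<noteq> {}"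
  by (force simp: hits_def through_def path_trace_def)

lemma through_subset_hits: "z \<in> C \<Longrightarrow> through z \<subseteq> hits C"
  by (auto simp: hits_def)

lemma hits_mono: "C \<subseteq> D \<Longrightarrow> hits C \<subseteq> hits D"
  by (auto simp: hits_def)

lemma Wcross_eq: "Wcross v y = Wpaths \<inter> hits (cone v y) \<inter> hits (cone_rev v y)"
  by (auto simp: Wcross_def hits_iff)

lemma sets_Wcross [measurable]: "Wcross v y \<in> sets path_space"
  unfolding Wcross_eq by measurable

lemma path_shift_through: "path_shift y w \<in> through z \<longleftrightarrow> w \<in> through (z + y)"
  by (auto simp: path_shift_def through_def)

text \<open>The hypothesis says that \<open>D\<close> is \<open>C\<close> translated by
  \<open>y\<close>.\<close>

lemma path_shift_hits:
  assumes "\<And>z. z + y \<in> D \<longleftrightarrow> z \<in> C"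
  shows "path_shift y w \<in> hits C \<longleftrightarrow> w \<in> hits D"
proof
  assume "w \<in> hits D"
  then obtain z where z: "z \<in> D" "w \<in> through z" by (auto simp: hits_def)
  then have "z - y \<in> C" "path_shift y w \<in> through (z - y)"
    using assms[of "z - y"] by (simp_all add: path_shift_through)
  then show "path_shift y w \<in> hits C" unfolding hits_def by blast
qed (use assms in \<open>auto simp: hits_def path_shift_through\<close>)

lemma path_shift_Wpaths: "path_shift y w \<in> Wpaths \<longleftrightarrow> w \<in> Wpaths"
proof -
  have "(\<forall>n. \<bar>w (n + snd y + 1) - w (n + snd y)\<bar> \<le> 1) \<longleftrightarrow> (\<forall>n. \<bar>w (n + 1) - w n\<bar> \<le> 1)"
    by (metis diff_add_cancel)
  then show ?thesis by (simp add: Wpaths_def path_shift_def algebra_simps)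
qed

lemma path_shift_Wcross: "path_shift y -` Wcross v 0 = Wcross v y"
  using path_shift_hits[of y "cone v y" "cone v 0"] path_shift_hits[of y "cone_rev v y" "cone_rev v 0"]
  by (auto simp: Wcross_eq path_shift_Wpaths cone_translate cone_rev_translate)

lemma occupied_iff: "z \<in> occupied m \<longleftrightarrow> (\<exists>w\<in>through z. m w \<noteq> 0)"
  by (cases z) (auto simp: occupied_def through_def)

text \<open>\<open>v\<close> is the slope of the cones, \<open>vstar / 3\<close> in the theorem.\<close>

locale walk_params =
  fixes pc pb v :: real
  assumes v: "0 < v" "v < 1"
begin

abbreviation St :: "env \<Rightarrow> int \<times> int \<Rightarrow> int \<times> int" where
  "St e \<equiv> Ystep pc pb (fst e) (snd e)"

abbreviation Y :: "env \<Rightarrow> int \<times> int \<Rightarrow> nat \<Rightarrow> int \<times> int" where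
  "Y e \<equiv> Ypos pc pb (fst e) (snd e)"

abbreviation good :: "env \<Rightarrow> int \<times> int \<Rightarrow> bool" where
  "good e \<equiv> good_point pc pb v (fst e) (snd e)"

abbreviation regen :: "env \<Rightarrow> enat" where
  "regen e \<equiv> regen_time pc pb v (fst e) (snd e)"

lemma good_iff: "good e y \<longleftrightarrow> (\<forall>w\<in>Wcross v y. fst e w = 0) \<and> (\<forall>i. Y e y i \<in> cone v y)"
  by (simp add: good_point_def count_in_eq_0_iff stays_in_cone_def)

lemma Y_0 [simp]: "Y e y 0 = y"
  and Y_Suc: "Y e y (Suc i) = St e (Y e y i)"
  by (simp_all add: Ypos_def)

lemma Y_add: "Y e y (m + i) = Y e (Y e y m) i"
  by (induction i) (simp_all add: Y_Suc)

lemma snd_Y: "snd (Y e y i) = snd y + int i"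
  by (induction i) (simp_all add: Y_Suc Ystep_def)

text \<open>Turns an event about the random trajectory into conditions at the fixed sites
  \<open>p i\<close>, so that only the environment at those sites matters.\<close>

lemma Y_eq_iff: "(\<forall>i\<le>n. Y e y i = p i) \<longleftrightarrow> p 0 = y \<and> (\<forall>i<n. St e (p i) = p (Suc i))"
proof (induction n)
  case (Suc n)
  have "(\<forall>i\<le>Suc n. Y e y i = p i) \<longleftrightarrow> (\<forall>i\<le>n. Y e y i = p i) \<and> St e (Y e y n) = p (Suc n)"
    by (auto simp: le_Suc_eq Y_Suc)
  also have "\<dots> \<longleftrightarrow> (\<forall>i\<le>n. Y e y i = p i) \<and> St e (p n) = p (Suc n)"
    by auto
  finally show ?case
    by (simp add: Suc.IH less_Suc_eq) blast
qed auto

lemma occupied_shift: "z \<in> occupied (fst (env_shift y e)) \<longleftrightarrow> z + y \<in> occupied (fst e)"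
  using env_shift_void[of "through z" y e] path_shift_through[of y _ z]
  unfolding occupied_iff vimage_def by auto

lemma St_shift: "St (env_shift y e) z = St e (z + y) - y"
proof -
  have "snd (env_shift y e) z = snd e (z + y)" by (simp add: env_shift_def)
  then show ?thesis
    unfolding Ystep_def occupied_shift by (auto simp: prod_eq_iff)
qed

lemma Y_shift: "Y (env_shift y e) 0 i = Y e y i - y"
  by (induction i) (simp_all add: Y_Suc St_shift)

lemma good_shift: "good (env_shift y e) 0 \<longleftrightarrow> good e y"
  unfolding good_iff env_shift_void path_shift_Wcross Y_shift
  using cone_translate[of "Y e y _ - y" y v] by simp

text \<open>One step looks only at the paths through \<open>z\<close> and at the mark of
  \<open>z\<close>.\<close>

lemma measurable_St:
  assumes "through z \<subseteq> G" "z \<in> R"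
  shows "(\<lambda>e. St e z) \<in> env_space \<rho> q G R \<rightarrow>\<^sub>M count_space UNIV"
proof -
  have [measurable]: "Measurable.pred (env_space \<rho> q G R) (\<lambda>e. z \<in> occupied (fst e))"
  proof -
    have "{e. z \<in> occupied (fst e)} = space (env_space \<rho> q G R) - {e. \<forall>w\<in>through z. fst e w = 0}"
      by (auto simp: occupied_iff)
    also have "\<dots> \<in> sets (env_space \<rho> q G R)"
      using assms by (intro sets.compl_sets void_in_sets_env_space) auto
    finally show ?thesis by (simp add: pred_def)
  qed
  have [measurable]: "(\<lambda>e. snd e z) \<in> borel_measurable (env_space \<rho> q G R)"
    by (rule measurable_mark[OF assms(2)])
  show ?thesis unfolding Ystep_def by measurable
qed

lemma measurable_trajectory:
  assumes "\<And>i. (\<lambda>e. f e i) \<in> N \<rightarrow>\<^sub>M count_space UNIV"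
  shows "f \<in> N \<rightarrow>\<^sub>M traj_space"
  using assms unfolding traj_space_def by (intro measurable_PiM_single') auto

text \<open>Freezing the walk when it leaves the cone makes it a function of the environment seen
  from the cone, without changing it on the event that it stays in the cone.\<close>

lemma forward_event:
  assumes B: "B \<in> sets traj_space"
  shows "{e. good e y \<and> (\<lambda>i. Y e y i - y) \<in> B} \<in> sets (env_space \<rho> q (hits (cone v y)) (cone v y))"
proof -
  let ?N = "env_space \<rho> q (hits (cone v y)) (cone v y)"
  define ks where "ks = (\<lambda>e z. if z \<in> cone v y then St e z else z)"
  define kY where "kY = (\<lambda>e i. (ks e ^^ i) y)"
  have ks: "(\<lambda>e. ks e z) \<in> ?N \<rightarrow>\<^sub>M count_space UNIV" for z
    by (cases "z \<in> cone v y") (auto simp: ks_def intro!: measurable_St through_subset_hits)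
  have kY[measurable]: "(\<lambda>e. kY e i) \<in> ?N \<rightarrow>\<^sub>M count_space UNIV" for i
  proof (induction i)
    case (Suc i)
    have "(\<lambda>e. ks e (kY e i)) \<in> ?N \<rightarrow>\<^sub>M count_space UNIV"
      by (rule measurable_compose_countable[OF ks Suc])
    then show ?case by (simp add: kY_def)
  qed (simp add: kY_def)
  have "(\<lambda>e i. kY e i - y) \<in> ?N \<rightarrow>\<^sub>M traj_space"
    by (rule measurable_trajectory, rule measurable_compose[OF kY]) simp
  from measurable_sets[OF this B] have 1: "{e. (\<lambda>i. kY e i - y) \<in> B} \<in> sets ?N"
    by (simp add: vimage_def)
  have "{e \<in> space ?N. \<forall>i. kY e i \<in> cone v y} \<in> sets ?N"
    by measurable
  then have 2: "{e. \<forall>i. kY e i \<in> cone v y} \<in> sets ?N" by simp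
  have 3: "{e. \<forall>w\<in>Wcross v y. fst e w = 0} \<in> sets ?N"
    by (rule void_in_sets_env_space) (auto simp: Wcross_eq)
  \<comment> \<open>The disjunction lets the induction run as long as either walk stays in the cone,
    which gives both directions of \<open>stays\<close>.\<close>
  have kY_eq: "kY e i = Y e y i" if "\<forall>j<i. Y e y j \<in> cone v y \<or> kY e j \<in> cone v y" for e i
    using that by (induction i) (auto simp: kY_def ks_def Y_Suc)
  have stays: "(\<forall>i. kY e i \<in> cone v y) \<longleftrightarrow> (\<forall>i. Y e y i \<in> cone v y)" for e
    using kY_eq by metis
  have "{e. good e y \<and> (\<lambda>i. Y e y i - y) \<in> B} = {e. \<forall>w\<in>Wcross v y. fst e w = 0} \<inter>
      ({e. \<forall>i. kY e i \<in> cone v y} \<inter> {e. (\<lambda>i. kY e i - y) \<in> B})"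
    using kY_eq by (auto simp: good_iff stays)
  also have "\<dots> \<in> sets ?N"
    by (intro sets.Int 1 2 3)
  finally show ?thesis .
qed

lemma measurable_Y: "(\<lambda>e. Y e y i) \<in> env_space \<rho> q UNIV UNIV \<rightarrow>\<^sub>M count_space UNIV"
proof (induction i)
  case (Suc i)
  show ?case
    unfolding Y_Suc by (rule measurable_compose_countable[OF measurable_St Suc]) auto
qed simp

lemma pred_good: "Measurable.pred (env_space \<rho> q UNIV UNIV) (\<lambda>e. good e y)"
  using forward_event[OF sets.top, of y \<rho> q] sets_env_space_mono[of _ UNIV _ UNIV \<rho> q]
  by (auto simp: pred_def traj_space_def space_PiM)

section \<open>Records and the regeneration time\<close>

definition reaches :: "nat \<Rightarrow> (nat \<Rightarrow> int \<times> int) \<Rightarrow> nat \<Rightarrow> bool" where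
  "reaches k p n \<longleftrightarrow> (1 - v) * real k + v * real n \<le> real_of_int (fst (p n))"

text \<open>The index is forgotten: \<open>n\<close> is the record time of some
  \<open>k \<ge> 1\<close>. This allows regeneration to be expressed through times only.\<close>

definition is_record :: "(nat \<Rightarrow> int \<times> int) \<Rightarrow> nat \<Rightarrow> bool" where
  "is_record p n \<longleftrightarrow> (\<exists>k\<ge>1. reaches k p n \<and> (\<forall>m<n. \<not> reaches k p m))"

lemma is_record_cong: "(\<And>i. i \<le> n \<Longrightarrow> p i = p' i) \<Longrightarrow> is_record p n = is_record p' n"
  by (simp add: is_record_def reaches_def)

abbreviation rt :: "env \<Rightarrow> nat \<Rightarrow> enat" where
  "rt e \<equiv> record_time pc pb v (fst e) (snd e)"

lemma record_time_eq_iff: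
  "rt e k = enat n \<longleftrightarrow> reaches k (Y e (0,0)) n \<and> (\<forall>m<n. \<not> reaches k (Y e (0,0)) m)"
proof -
  have "rt e k = (if \<exists>n. reaches k (Y e (0,0)) n then enat (LEAST n. reaches k (Y e (0,0)) n) else \<infinity>)"
    by (simp add: record_time_def Xpos_def reaches_def Let_def)
  then show ?thesis
    by (auto intro: LeastI dest: not_less_Least) (metis LeastI not_less_Least linorder_neqE_nat)+
qed

text \<open>The thresholds \<open>(1 - v) * k\<close> increase with \<open>k\<close> because
  \<open>v < 1\<close>, so a time that reaches level \<open>k\<close> also reaches every lower
  level.\<close>

lemma record_time_mono:
  assumes "j \<le> k" shows "rt e j \<le> rt e k"
proof (cases "rt e k")
  case (enat n)
  then have n: "reaches k (Y e (0,0)) n" by (simp add: record_time_eq_iff)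
  have "(1 - v) * real j \<le> (1 - v) * real k"
    using assms v by (intro mult_left_mono) auto
  with n have *: "reaches j (Y e (0,0)) n"
    by (simp add: reaches_def)
  then obtain m where "m \<le> n" "reaches j (Y e (0,0)) m" "\<forall>i<m. \<not> reaches j (Y e (0,0)) i"
    using exists_least_iff[of "reaches j (Y e (0,0))"] by (metis not_less)
  then show ?thesis using enat record_time_eq_iff[of e j m] by simp
qed simp

text \<open>The definition minimises over record indices, the right-hand side over times.
  Monotonicity of the record times makes the two minima agree.\<close>

lemma regen_eq_iff: "regen e = enat n \<longleftrightarrow> is_record (Y e (0,0)) n \<and> good e (Y e (0,0) n) \<and>
    (\<forall>m<n. is_record (Y e (0,0)) m \<longrightarrow> \<not> good e (Y e (0,0) m))"
proof -
  define G where "G = (\<lambda>k. 1 \<le> k \<and> rt e k \<noteq> \<infinity> \<and> good e (Y e (0,0) (the_enat (rt e k))))"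
  have regen: "regen e = (if \<exists>k. G k then rt e (LEAST k. G k) else \<infinity>)"
    unfolding regen_time_def Let_def G_def by (rule refl)
  have rec: "is_record (Y e (0,0)) m \<and> good e (Y e (0,0) m) \<longleftrightarrow> (\<exists>k. G k \<and> rt e k = enat m)" for m
    unfolding is_record_def G_def record_time_eq_iff[symmetric] by auto
  have least: "rt e (LEAST k. G k) \<le> rt e k" if "G k" for k
    by (rule record_time_mono) (rule Least_le[of G, OF that])
  show ?thesis
  proof
    assume *: "regen e = enat n"
    then have G: "G (LEAST k. G k)" "rt e (LEAST k. G k) = enat n"
      by (auto simp: regen split: if_splits intro: LeastI)
    then have "\<not> (is_record (Y e (0,0)) m \<and> good e (Y e (0,0) m))" if "m < n" for m
      using least that unfolding rec by fastforce
    with rec[of n] G show "is_record (Y e (0,0)) n \<and> good e (Y e (0,0) n) \<and>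
        (\<forall>m<n. is_record (Y e (0,0)) m \<longrightarrow> \<not> good e (Y e (0,0) m))"
      by blast
  next
    assume R: "is_record (Y e (0,0)) n \<and> good e (Y e (0,0) n) \<and>
        (\<forall>m<n. is_record (Y e (0,0)) m \<longrightarrow> \<not> good e (Y e (0,0) m))"
    then obtain k where k: "G k" "rt e k = enat n" using rec[of n] by blast
    then obtain m where m: "rt e (LEAST k. G k) = enat m" "m \<le> n"
      using least[OF k(1)] by (cases "rt e (LEAST k. G k)") auto
    have "G (LEAST k. G k)" using k(1) by (rule LeastI)
    with m(1) rec[of m] have "is_record (Y e (0,0)) m \<and> good e (Y e (0,0) m)" by blast
    with R m(2) have "m = n" by (metis le_neq_implies_less)
    with m k show "regen e = enat n" by (auto simp: regen)
  qed
qed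

lemma pred_regen_eq: "Measurable.pred (env_space \<rho> q UNIV UNIV) (\<lambda>e. regen e = enat n)"
proof -
  note [measurable] = measurable_Y[of "(0,0)" _ \<rho> q]
  have [measurable]: "Measurable.pred (env_space \<rho> q UNIV UNIV) (\<lambda>e. is_record (Y e (0,0)) n)" for n
    unfolding is_record_def reaches_def by measurable
  have [measurable]: "Measurable.pred (env_space \<rho> q UNIV UNIV) (\<lambda>e. good e (Y e (0,0) n))" for n
    by (rule measurable_compose_countable[OF pred_good measurable_Y])
  show ?thesis unfolding regen_eq_iff by measurable
qed

lemma measurable_regen: "regen \<in> env_space \<rho> q UNIV UNIV \<rightarrow>\<^sub>M count_space UNIV"
proof -
  have "regen -` {t} \<inter> space (env_space \<rho> q UNIV UNIV) \<in> sets (env_space \<rho> q UNIV UNIV)" for t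
  proof (cases t)
    case (enat n)
    then show ?thesis using pred_regen_eq[of n \<rho> q] by (simp add: pred_def vimage_def)
  next
    case infinity
    have "{e. regen e = \<infinity>} = UNIV - (\<Union>n. {e. regen e = enat n})"
      by (auto simp: not_infinity_eq)
    also have "\<dots> \<in> sets (env_space \<rho> q UNIV UNIV)"
      using pred_regen_eq[of _ \<rho> q] by (intro sets.Diff sets.countable_UN') (auto simp: pred_def)
    finally show ?thesis using infinity by (simp add: vimage_def)
  qed
  then show ?thesis by (subst measurable_count_space_eq_countable) auto
qed

text \<open>The level \<open>(1 - v) * k\<close> first attained at \<open>n\<close> separates the
  two values.\<close>

lemma is_record_strict:
  assumes "is_record p n" "m < n"
  shows "real_of_int (fst (p m)) - v * real m < real_of_int (fst (p n)) - v * real n"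
  using assms by (force simp: is_record_def reaches_def)

text \<open>The strict inequality for space minus \<open>v\<close> times time is the slope condition
  of both cones. The order of the spatial coordinates follows from it because \<open>v\<close> is
  positive.\<close>

lemma record_past_in_cone_rev:
  assumes "is_record p n" "m < n" "snd (p m) = int m" "snd (p n) = int n"
  shows "p m \<in> cone_rev v (p n)" and "p n \<in> cone v (p m)"
proof -
  have *: "real_of_int (fst (p m)) - v * real m < real_of_int (fst (p n)) - v * real n"
    by (rule is_record_strict[OF assms(1,2)])
  moreover have "v * real m \<le> v * real n"
    using assms v by (intro mult_left_mono) auto
  ultimately have "real_of_int (fst (p m)) < real_of_int (fst (p n))" by linarith
  with * assms show "p m \<in> cone_rev v (p n)" "p n \<in> cone v (p m)"
    by (auto simp: cone_rev_iff cone_iff algebra_simps)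
qed

end

section \<open>Splitting the environment at a regeneration point\<close>

context walk_params
begin

text \<open>Goodness of \<open>p m\<close> with the walk checked only up to time \<open>n\<close>,
  so that it is decided by the past. For \<open>m < n\<close> and a walk that follows
  \<open>p\<close> to a record at \<open>n\<close>, it agrees with goodness as soon as
  \<open>p n\<close> is good.\<close>

definition clean_until :: "env \<Rightarrow> (nat \<Rightarrow> int \<times> int) \<Rightarrow> nat \<Rightarrow> nat \<Rightarrow> bool" where
  "clean_until e p m n \<longleftrightarrow>
     (\<forall>w\<in>Wcross v (p m). fst e w = 0) \<and> (\<forall>i. m \<le> i \<and> i \<le> n \<longrightarrow> p i \<in> cone v (p m))"

text \<open>The flag \<open>c\<close> adds goodness of the origin, again with finite horizon, so
  that one argument serves both the law and the conditioned law.\<close>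

definition past_event :: "bool \<Rightarrow> (nat \<Rightarrow> int \<times> int) \<Rightarrow> nat \<Rightarrow> env set" where
  "past_event c p n = {e. (\<forall>i<n. St e (p i) = p (Suc i)) \<and> (c \<longrightarrow> clean_until e p 0 n) \<and>
     (\<forall>m<n. is_record p m \<longrightarrow> \<not> clean_until e p m n)}"

text \<open>Marks are read only at \<open>p i\<close> with \<open>i < n\<close>. All paths are
  allowed here; \<open>thin\<close> restricts them afterwards.\<close>

lemma past_event_in_sets:
  assumes "\<And>i. i < n \<Longrightarrow> p i \<in> R"
  shows "past_event c p n \<in> sets (env_space \<rho> q UNIV R)"
proof -
  have [measurable]: "Measurable.pred (env_space \<rho> q UNIV R) (\<lambda>e. clean_until e p m n)" for m
  proof -
    have "Measurable.pred (env_space \<rho> q UNIV R) (\<lambda>e. \<forall>w\<in>Wcross v (p m). fst e w = 0)"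
      using void_in_sets_env_space[OF sets_Wcross subset_UNIV] by (simp add: pred_def)
    then show ?thesis unfolding clean_until_def by measurable
  qed
  have [measurable]: "(\<lambda>e. St e (p i)) \<in> env_space \<rho> q UNIV R \<rightarrow>\<^sub>M count_space UNIV" if "i \<in> {..<n}" for i
    using assms that by (intro measurable_St) auto
  have "Measurable.pred (env_space \<rho> q UNIV R) (\<lambda>e. \<forall>i\<in>{..<n}. St e (p i) = p (Suc i))"
    by measurable
  then have [measurable]: "Measurable.pred (env_space \<rho> q UNIV R) (\<lambda>e. \<forall>i<n. St e (p i) = p (Suc i))"
    by (simp add: Ball_def)
  have "{e \<in> space (env_space \<rho> q UNIV R). (\<forall>i<n. St e (p i) = p (Suc i)) \<and> (c \<longrightarrow> clean_until e p 0 n) \<and>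
     (\<forall>m<n. is_record p m \<longrightarrow> \<not> clean_until e p m n)} \<in> sets (env_space \<rho> q UNIV R)"
    by measurable
  then show ?thesis by (simp add: past_event_def)
qed

definition outer_paths :: "int \<times> int \<Rightarrow> (int \<Rightarrow> int) set" where
  "outer_paths y = - hits (cone v y)"

lemma sets_outer_paths: "outer_paths y \<in> sets path_space"
  using sets.compl_sets[OF sets_hits[of "cone v y"]] by (simp add: outer_paths_def Compl_eq_Diff_UNIV)

text \<open>A path deleted by thinning meets the forward cone. If it also meets the reversed cone,
  it lies in \<open>Wcross\<close> or off \<open>Wpaths\<close>, and has multiplicity zero in either
  case.\<close>

lemma fst_thin_eq_0_iff:
  assumes "\<forall>w. w \<notin> Wpaths \<longrightarrow> fst e w = 0" "\<forall>w\<in>Wcross v y. fst e w = 0" "w \<in> hits (cone_rev v y)"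
  shows "fst (thin (outer_paths y) e) w = fst e w"
  using assms by (auto simp: thin_def outer_paths_def Wcross_eq)

definition reg_at :: "bool \<Rightarrow> env \<Rightarrow> (nat \<Rightarrow> int \<times> int) \<Rightarrow> nat \<Rightarrow> bool" where
  "reg_at c e p n \<longleftrightarrow> (c \<longrightarrow> good e (0, 0)) \<and> regen e = enat n \<and> (\<forall>i\<le>n. Y e (0, 0) i = p i)"

text \<open>When \<open>p n\<close> is good, deleting the paths that meet its forward cone changes
  nothing the past can see, and goodness at earlier points reduces to its finite horizon version.
  This separates past and future.\<close>

lemma reg_at_iff:
  assumes supp: "\<forall>w. w \<notin> Wpaths \<longrightarrow> fst e w = 0"
    and rec: "is_record p n" and p0: "p 0 = (0, 0)" and snd_p: "\<And>i. i \<le> n \<Longrightarrow> snd (p i) = int i"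
  shows "reg_at c e p n \<longleftrightarrow> thin (outer_paths (p n)) e \<in> past_event c p n \<and> good e (p n)"
proof (cases "good e (p n)")
  case False
  then show ?thesis unfolding reg_at_def regen_eq_iff by (metis le_refl)
next
  case True
  let ?t = "thin (outer_paths (p n)) e"
  have void: "\<forall>w\<in>Wcross v (p n). fst e w = 0" and stays: "\<And>i. Y e (p n) i \<in> cone v (p n)"
    using True by (simp_all add: good_iff)
  \<comment> \<open>The origin at time 0 is below every level with \<open>k \<ge> 1\<close>. Hence
    the origin is a strictly earlier point, and \<open>clean\<close> applies to it when
    \<open>c\<close> holds.\<close>
  have "n \<noteq> 0"
  proof
    assume "n = 0"
    with rec p0 obtain k where "k \<ge> 1" "(1 - v) * real k \<le> 0"
      by (auto simp: is_record_def reaches_def)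
    with v show False by (auto simp: mult_le_0_iff)
  qed
  have past: "p m \<in> cone_rev v (p n)" "p n \<in> cone v (p m)" if "m < n" for m
    using record_past_in_cone_rev[OF rec that] snd_p that by simp_all
  \<comment> \<open>Sites of the reversed cone have the same occupation before and after thinning,
    and thinning does not touch the marks.\<close>
  have "St ?t z = St e z" if z: "z \<in> cone_rev v (p n)" for z
  proof -
    have "fst ?t w = fst e w" if "w \<in> through z" for w
      using that through_subset_hits[OF z] by (intro fst_thin_eq_0_iff[OF supp void]) auto
    then have "z \<in> occupied (fst ?t) \<longleftrightarrow> z \<in> occupied (fst e)"
      by (simp add: occupied_iff)
    moreover have "snd ?t = snd e" by (simp add: thin_def)
    ultimately show ?thesis by (simp add: Ystep_def)
  qed
  with past(1) have steps: "(\<forall>i<n. St ?t (p i) = p (Suc i)) \<longleftrightarrow> (\<forall>i\<le>n. Y e (0,0) i = p i)"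
    unfolding Y_eq_iff using p0 by simp
  show ?thesis
  proof (cases "\<forall>i\<le>n. Y e (0,0) i = p i")
    case False
    with steps show ?thesis by (simp add: reg_at_def past_event_def) blast
  next
    case Yp: True
    have clean: "good e (p m) \<longleftrightarrow> clean_until ?t p m n" if m: "m < n" for m
    proof -
      have "fst ?t w = fst e w" if "w \<in> Wcross v (p m)" for w
      proof (rule fst_thin_eq_0_iff[OF supp void])
        \<comment> \<open>The crossing paths of an earlier point meet its reversed cone, which lies
          inside that of \<open>p n\<close>.\<close>
        have "cone_rev v (p m) \<subseteq> cone_rev v (p n)"
          using cone_rev_trans[OF past(1)[OF m]] by auto
        then show "w \<in> hits (cone_rev v (p n))"
          using that hits_mono[of "cone_rev v (p m)" "cone_rev v (p n)"] by (auto simp: Wcross_eq)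
      qed
      then have 1: "(\<forall>w\<in>Wcross v (p m). fst ?t w = 0) \<longleftrightarrow> (\<forall>w\<in>Wcross v (p m). fst e w = 0)"
        by simp
      have Ym: "Y e (p m) i = Y e (0,0) (m + i)" for i
        using Yp m by (simp add: Y_add)
      \<comment> \<open>From time \<open>n\<close> on the walk stays in the cone of
        \<open>p n\<close>, which is contained in that of \<open>p m\<close>, so only times up to
        \<open>n\<close> remain to be checked.\<close>
      have late: "Y e (0,0) (n + i) \<in> cone v (p m)" for i
        using cone_trans[OF past(2)[OF m] stays] Yp by (simp add: Y_add)
      have "(\<forall>i. Y e (p m) i \<in> cone v (p m)) \<longleftrightarrow> (\<forall>i. m \<le> i \<and> i \<le> n \<longrightarrow> p i \<in> cone v (p m))"
      proof
        assume L: "\<forall>i. Y e (p m) i \<in> cone v (p m)"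
        show "\<forall>i. m \<le> i \<and> i \<le> n \<longrightarrow> p i \<in> cone v (p m)"
        proof (intro allI impI)
          fix i assume i: "m \<le> i \<and> i \<le> n"
          with L[rule_format, of "i - m"] Yp show "p i \<in> cone v (p m)" by (simp add: Ym)
        qed
      next
        assume R: "\<forall>i. m \<le> i \<and> i \<le> n \<longrightarrow> p i \<in> cone v (p m)"
        show "\<forall>i. Y e (p m) i \<in> cone v (p m)"
        proof
          fix i
          show "Y e (p m) i \<in> cone v (p m)"
          proof (cases "m + i \<le> n")
            case True
            with R[rule_format, of "m + i"] Yp show ?thesis by (simp add: Ym)
          next
            case False
            with late[of "m + i - n"] show ?thesis by (simp add: Ym)
          qed
        qed
      qed
      with 1 show ?thesis by (simp add: good_iff clean_until_def)
    qed
    have rec_eq: "is_record (Y e (0,0)) m = is_record p m" if "m \<le> n" for m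
      using that Yp by (intro is_record_cong) auto
    have "regen e = enat n \<longleftrightarrow> (\<forall>m<n. is_record p m \<longrightarrow> \<not> clean_until ?t p m n)"
      unfolding regen_eq_iff using rec_eq rec True Yp clean by auto
    moreover have "good e (0,0) \<longleftrightarrow> clean_until ?t p 0 n"
      using clean[of 0] \<open>n \<noteq> 0\<close> p0 by simp
    ultimately show ?thesis
      using Yp steps True unfolding reg_at_def past_event_def by blast
  qed
qed

text \<open>These constraints on \<open>p\<close> are necessary, so for any other \<open>p\<close>
  the factorization holds trivially with constant zero.\<close>

lemma reg_at_record:
  assumes "reg_at c e p n"
  shows "is_record p n" "p 0 = (0, 0)" "i \<le> n \<Longrightarrow> snd (p i) = int i"
proof -
  have Yp: "\<And>i. i \<le> n \<Longrightarrow> p i = Y e (0,0) i" and "is_record (Y e (0,0)) n"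
    using assms by (auto simp: reg_at_def regen_eq_iff)
  then show "is_record p n" using is_record_cong[of n p "Y e (0,0)"] by simp
  show "p 0 = (0,0)" "i \<le> n \<Longrightarrow> snd (p i) = int i" using Yp by (simp_all add: snd_Y)
qed

definition post :: "env \<Rightarrow> nat \<Rightarrow> nat \<Rightarrow> int \<times> int" where
  "post e n = (\<lambda>i. Y e (0, 0) (n + i) - Y e (0, 0) n)"

lemma post_eq: "Y e (0, 0) n = y \<Longrightarrow> post e n = (\<lambda>i. Y e y i - y)"
  by (simp add: post_def Y_add)

lemma pred_reg_at: "Measurable.pred (env_space \<rho> q UNIV UNIV) (\<lambda>e. reg_at c e p n)"
proof -
  note [measurable] = measurable_Y[of "(0,0)" _ \<rho> q] pred_good[of "(0,0)" \<rho> q] pred_regen_eq[of n \<rho> q]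
  show ?thesis unfolding reg_at_def by measurable
qed

lemma measurable_post: "(\<lambda>e. post e n) \<in> env_space \<rho> q UNIV UNIV \<rightarrow>\<^sub>M traj_space"
proof -
  have "(\<lambda>e. post e n i) \<in> env_space \<rho> q UNIV UNIV \<rightarrow>\<^sub>M count_space UNIV" for i
    unfolding post_def
    by (rule measurable_compose_countable[where g = "\<lambda>e. Y e (0,0) n" and f = "\<lambda>y e. Y e (0,0) (n + i) - y"])
      (auto intro: measurable_compose[OF measurable_Y] measurable_Y)
  then show ?thesis by (rule measurable_trajectory)
qed

end

section \<open>Factorization at a regeneration point\<close>

locale rw_walk = rw_environment M om U \<rho> q + walk_params pc pb v
  for M :: "'a measure" and om U \<rho> q pc pb v
begin

text \<open>The law of the walk under \<open>P_angle\<close> before normalization, meaningful even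
  if the good event is null.\<close>

definition good_law :: "(nat \<Rightarrow> int \<times> int) set \<Rightarrow> real" where
  "good_law B = measure env_law {e. good e (0, 0) \<and> Y e (0, 0) \<in> B}"

text \<open>The event is the preimage under \<open>env_shift y\<close> of the one at the origin, and
  \<open>env_law\<close> is invariant.\<close>

lemma good_event_shift:
  assumes B: "B \<in> sets traj_space"
  shows "measure env_law {e. good e y \<and> (\<lambda>i. Y e y i - y) \<in> B} = good_law B"
proof -
  let ?D = "{e. good e 0 \<and> (\<lambda>i. Y e 0 i) \<in> B}"
  have D: "?D \<in> sets (env_space \<rho> q UNIV UNIV)"
    using subsetD[OF sets_env_space_mono[OF subset_UNIV subset_UNIV] forward_event[OF B, of 0]] by simp
  have *: "env_shift y \<in> env_law \<rightarrow>\<^sub>M env_space \<rho> q UNIV UNIV"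
    using measurable_env_shift by (simp cong: measurable_cong_sets)
  have "good_law B = measure (distr env_law (env_space \<rho> q UNIV UNIV) (env_shift y)) ?D"
    by (simp add: good_law_def env_law_shift zero_prod_def)
  also have "\<dots> = measure env_law (env_shift y -` ?D)"
    using measure_distr[OF * D] by simp
  also have "env_shift y -` ?D = {e. good e y \<and> (\<lambda>i. Y e y i - y) \<in> B}"
  proof -
    have "Y (env_shift y e) 0 = (\<lambda>i. Y e y i - y)" for e
      by (rule ext) (rule Y_shift)
    then show ?thesis by (simp add: vimage_def good_shift)
  qed
  finally show ?thesis by simp
qed

text \<open>The constant \<open>b\<close> is chosen before \<open>B\<close>: it is the probability
  of the past event in the thinned environment, or zero if \<open>p\<close> cannot lead to a record.
  Past and future live on complementary sets of paths and sites.\<close>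

lemma regeneration_factorization:
  obtains b where "\<And>B. B \<in> sets traj_space \<Longrightarrow>
    measure env_law {e. reg_at c e p n \<and> post e n \<in> B} = b * good_law B"
proof (cases "is_record p n \<and> p 0 = (0, 0) \<and> (\<forall>i\<le>n. snd (p i) = int i)")
  case False
  then have "\<not> reg_at c e p n" for e
    using reg_at_record by blast
  then show ?thesis by (intro that[of 0]) simp
next
  case True
  let ?y = "p n"
  let ?P = "thin (outer_paths ?y) -` past_event c p n"
  have P: "?P \<in> sets (env_space \<rho> q (- hits (cone v ?y)) (- cone v ?y))"
  proof -
    \<comment> \<open>Earlier sites lie in the reversed cone of the record, hence off its forward
      cone.\<close>
    have "past_event c p n \<in> sets (env_space \<rho> q UNIV (- cone v ?y))"
      using record_past_in_cone_rev(1)[of p n] True cone_rev_disjoint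
      by (intro past_event_in_sets) auto
    from measurable_sets[OF measurable_thin[OF sets_outer_paths] this] show ?thesis
      by (simp add: outer_paths_def)
  qed
  show ?thesis
  proof (rule that[of "measure env_law ?P"])
    fix B assume B: "B \<in> sets traj_space"
    let ?F = "{e. good e ?y \<and> (\<lambda>i. Y e ?y i - ?y) \<in> B}"
    have F: "?F \<in> sets (env_space \<rho> q (hits (cone v ?y)) (cone v ?y))"
      by (rule forward_event[OF B])
    \<comment> \<open>The two events agree up to a null set, since the splitting needs a
      configuration supported on \<open>Wpaths\<close>.\<close>
    have "measure env_law {e. reg_at c e p n \<and> post e n \<in> B} = measure env_law (?F \<inter> ?P)"
    proof (rule law.finite_measure_eq_AE)
      show "AE e in env_law. e \<in> {e. reg_at c e p n \<and> post e n \<in> B} \<longleftrightarrow> e \<in> ?F \<inter> ?P"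
        using AE_env_law_Wpaths
      proof eventually_elim
        case (elim e)
        then have iff: "reg_at c e p n \<longleftrightarrow> thin (outer_paths ?y) e \<in> past_event c p n \<and> good e ?y"
          using True by (intro reg_at_iff) auto
        have "post e n = (\<lambda>i. Y e ?y i - ?y)" if "reg_at c e p n"
          using that by (intro post_eq) (simp add: reg_at_def)
        with iff show ?case by auto
      qed
      have "{e \<in> space (env_space \<rho> q UNIV UNIV). reg_at c e p n} \<inter>
          ((\<lambda>e. post e n) -` B \<inter> space (env_space \<rho> q UNIV UNIV)) \<in> sets (env_space \<rho> q UNIV UNIV)"
        using pred_reg_at measurable_sets[OF measurable_post B] by (intro sets.Int) (auto simp: pred_def)
      moreover have "{e \<in> space (env_space \<rho> q UNIV UNIV). reg_at c e p n} \<inter>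
          ((\<lambda>e. post e n) -` B \<inter> space (env_space \<rho> q UNIV UNIV)) = {e. reg_at c e p n \<and> post e n \<in> B}"
        by auto
      ultimately show "{e. reg_at c e p n \<and> post e n \<in> B} \<in> law.events" by simp
      show "?F \<inter> ?P \<in> law.events"
        using F P sets_env_space_mono[OF subset_UNIV subset_UNIV] unfolding sets_env_law by blast
    qed
    also have "\<dots> = measure env_law ?F * measure env_law ?P"
      by (rule env_law_indep[OF F P])
    also have "\<dots> = measure env_law ?P * good_law B"
      by (simp add: good_event_shift[OF B])
    finally show "measure env_law {e. reg_at c e p n \<and> post e n \<in> B} = measure env_law ?P * good_law B" .
  qed
qed

end

text \<open>Inside \<open>T\<close> the map \<open>f\<close> has countably many values, so the
  defining integrals can be checked fibre by fibre. The identity on fibres is in product form, so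
  null fibres need no separate treatment. \<open>fib\<close> supplies measurability of the fibres,
  since points of \<open>K\<close> need not be measurable.\<close>

lemma real_cond_exp_eq_const:
  fixes f :: "'a \<Rightarrow> 'b" and c :: real
  assumes P: "prob_space P" and f[measurable]: "f \<in> P \<rightarrow>\<^sub>M K" and T[measurable]: "T \<in> sets K"
    and C: "countable C" "\<And>\<xi>. \<xi> \<in> space P \<Longrightarrow> f \<xi> \<in> T \<Longrightarrow> f \<xi> \<in> C"
    and X[measurable]: "X \<in> sets P" "\<And>\<xi>. \<xi> \<in> X \<Longrightarrow> f \<xi> \<in> T"
    and fib: "\<And>y. y \<in> C \<inter> T \<Longrightarrow> {\<xi> \<in> space P. f \<xi> = y} \<in> sets P"
    and c: "0 \<le> c"
    and eq: "\<And>y. y \<in> C \<inter> T \<Longrightarrow>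
      measure P ({\<xi> \<in> space P. f \<xi> = y} \<inter> X) = c * measure P {\<xi> \<in> space P. f \<xi> = y}"
  shows "AE \<xi> in P. f \<xi> \<in> T \<longrightarrow>
    real_cond_exp P (vimage_algebra (space P) f K) (indicator X) \<xi> = c"
proof -
  interpret P: prob_space P by fact
  let ?F = "vimage_algebra (space P) f K"
  have fK: "f \<in> space P \<rightarrow> space K" using measurable_space[OF f] by auto
  have "subalgebra P ?F"
    using f fK by (auto simp: subalgebra_def sets_vimage_algebra2)
  then interpret S: finite_measure_subalgebra P ?F by unfold_locales
  have fF: "f \<in> ?F \<rightarrow>\<^sub>M K" by (rule measurable_vimage_algebra1[OF fK])
  let ?T = "{\<xi> \<in> space P. f \<xi> \<in> T}"
  have T': "?T \<in> sets P" by measurable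
  \<comment> \<open>As \<open>X\<close> is contained in the event \<open>?T\<close>, the candidate
    version is \<open>c\<close> on \<open>?T\<close> and zero off it.\<close>
  have "AE \<xi> in P. real_cond_exp P ?F (indicator X) \<xi> = c * indicator ?T \<xi>"
  proof (rule S.real_cond_exp_charact)
    fix A assume "A \<in> sets ?F"
    then obtain R where R[measurable]: "R \<in> sets K" and A_eq: "A = f -` R \<inter> space P"
      using fK by (auto simp: sets_vimage_algebra2)
    have A[measurable]: "A \<in> sets P" unfolding A_eq by measurable
    \<comment> \<open>Within \<open>?T\<close>, a set \<open>A\<close> of the generated
      \<sigma>-algebra is the countable disjoint union of the fibres over \<open>I\<close>.\<close>
    define I where "I = C \<inter> T \<inter> R"
    define E where "E = (\<lambda>y. {\<xi> \<in> space P. f \<xi> = y})"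
    have I: "countable I" "I \<subseteq> C \<inter> T" using C(1) by (auto simp: I_def)
    have E: "E y \<in> sets P" if "y \<in> I" for y using fib that I by (auto simp: E_def)
    have disj: "disjoint_family_on E I" "disjoint_family_on (\<lambda>y. E y \<inter> X) I"
      by (auto simp: disjoint_family_on_def E_def)
    have eqs: "A \<inter> X = (\<Union>y\<in>I. E y \<inter> X)" "A \<inter> ?T = (\<Union>y\<in>I. E y)"
      using C(2) X(2) sets.sets_into_space[OF X(1)] by (auto simp: A_eq I_def E_def)
    have AT: "emeasure P (A \<inter> ?T) = (\<integral>\<^sup>+y. emeasure P (E y) \<partial>count_space I)"
      unfolding eqs by (rule emeasure_UN_countable[OF E I(1) disj(1)])
    have "emeasure P (A \<inter> X) = (\<integral>\<^sup>+y. emeasure P (E y \<inter> X) \<partial>count_space I)"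
      unfolding eqs by (rule emeasure_UN_countable[OF sets.Int[OF E X(1)] I(1) disj(2)])
    also have "\<dots> = (\<integral>\<^sup>+y. ennreal c * emeasure P (E y) \<partial>count_space I)"
      using eq I c by (intro nn_integral_cong)
        (auto simp: E_def P.emeasure_eq_measure ennreal_mult[symmetric])
    also have "\<dots> = ennreal c * emeasure P (A \<inter> ?T)"
      unfolding AT by (rule nn_integral_cmult) simp
    finally have "measure P (A \<inter> X) = c * measure P (A \<inter> ?T)"
      using c by (simp add: P.emeasure_eq_measure ennreal_mult[symmetric])
    moreover have "(\<integral>\<xi>\<in>A. indicator X \<xi> \<partial>P) = measure P (A \<inter> X)"
    proof -
      have "(\<integral>\<xi>\<in>A. indicator X \<xi> \<partial>P) = (\<integral>\<xi>. indicator (A \<inter> X) \<xi> \<partial>P)"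
        unfolding set_lebesgue_integral_def by (intro Bochner_Integration.integral_cong) (auto simp: indicator_def)
      also have "\<dots> = measure P (A \<inter> X)"
        using A X(1) by (simp add: Int_absorb2 sets.sets_into_space)
      finally show ?thesis .
    qed
    moreover have "(\<integral>\<xi>\<in>A. c * indicator ?T \<xi> \<partial>P) = c * measure P (A \<inter> ?T)"
    proof -
      have "(\<integral>\<xi>\<in>A. c * indicator ?T \<xi> \<partial>P) = (\<integral>\<xi>. c * indicator (A \<inter> ?T) \<xi> \<partial>P)"
        unfolding set_lebesgue_integral_def by (intro Bochner_Integration.integral_cong) (auto simp: indicator_def)
      also have "\<dots> = c * measure P (A \<inter> ?T)"
        using A T' by (simp add: Int_absorb2 sets.sets_into_space)
      finally show ?thesis .
    qed
    ultimately show "(\<integral>\<xi>\<in>A. indicator X \<xi> \<partial>P) = (\<integral>\<xi>\<in>A. c * indicator ?T \<xi> \<partial>P)"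
      by (simp only:)
  next
    show "integrable P (indicator X :: 'a \<Rightarrow> real)"
      using X(1) by (simp add: P.emeasure_eq_measure)
    show "integrable P (\<lambda>\<xi>. c * indicator ?T \<xi>)"
      using T' by (simp add: P.emeasure_eq_measure)
    have "?T \<in> sets ?F"
      using measurable_sets[OF fF T] by (simp add: vimage_def Int_def conj_commute)
    then show "(\<lambda>\<xi>. c * indicator ?T \<xi>) \<in> borel_measurable ?F"
      by measurable
  qed
  then show ?thesis
    using AE_space by eventually_elim simp
qed

section \<open>The past up to regeneration as a discrete variable\<close>

context walk_params
begin

abbreviation pre :: "env \<Rightarrow> enat \<times> (nat \<Rightarrow> int \<times> int)" where
  "pre e \<equiv> pre_regen pc pb v (fst e) (snd e)"

lemma measurable_pre: "pre \<in> env_space \<rho> q UNIV UNIV \<rightarrow>\<^sub>M count_space UNIV \<Otimes>\<^sub>M traj_space"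
proof -
  note [measurable] = measurable_regen[of \<rho> q] measurable_Y[of "(0,0)" _ \<rho> q]
  have "(\<lambda>e i. if enat i \<le> regen e then Y e (0,0) i else (0,0)) \<in> env_space \<rho> q UNIV UNIV \<rightarrow>\<^sub>M traj_space"
    by (rule measurable_trajectory) measurable
  then show ?thesis
    unfolding pre_regen_def by (intro measurable_Pair measurable_regen)
qed

text \<open>The hypothesis matches the padding in \<open>pre_regen\<close>, so equality of the
  trajectories is decided at times up to \<open>n\<close>.\<close>

lemma pre_eq_iff:
  assumes "\<And>i. n < i \<Longrightarrow> p i = (0, 0)"
  shows "pre e = (enat n, p) \<longleftrightarrow> reg_at False e p n"
proof -
  have "(\<lambda>i. if enat i \<le> enat n then Y e (0,0) i else (0,0)) = p \<longleftrightarrow> (\<forall>i\<le>n. Y e (0,0) i = p i)"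
    using assms by (auto simp: fun_eq_iff)
  then show ?thesis
    by (auto simp: pre_regen_def reg_at_def)
qed

text \<open>Contains every value of the past with finite regeneration time. Coding the trajectory by
  a finite list makes the set countable.\<close>

definition truncated :: "(enat \<times> (nat \<Rightarrow> int \<times> int)) set" where
  "truncated = range (\<lambda>(n, xs). (enat n, \<lambda>i. if i \<le> n then xs ! i else (0, 0)))"

lemma countable_truncated: "countable truncated"
  unfolding truncated_def by simp

lemma pre_in_truncated:
  assumes "fst (pre e) < \<infinity>" shows "pre e \<in> truncated"
proof -
  obtain n where n: "regen e = enat n"
    using assms by (auto simp: pre_regen_def)
  \<comment> \<open>The list holds the positions at times 0 to \<open>n\<close>, hence the upper end
    \<open>Suc n\<close>.\<close>
  have "pre e = (enat n, \<lambda>i. if i \<le> n then map (Y e (0,0)) [0..<Suc n] ! i else (0, 0))"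
    by (auto simp: pre_regen_def n fun_eq_iff simp del: upt_Suc)
  also have "\<dots> = (\<lambda>(n, xs). (enat n, \<lambda>i. if i \<le> n then xs ! i else (0, 0))) (n, map (Y e (0,0)) [0..<Suc n])"
    by (simp only: prod.case)
  finally show ?thesis unfolding truncated_def by blast
qed

lemma truncatedD: "y \<in> truncated \<Longrightarrow> \<exists>n p. y = (enat n, p) \<and> (\<forall>i. n < i \<longrightarrow> p i = (0, 0))"
  by (auto simp: truncated_def)

abbreviation regen_into :: "env \<Rightarrow> (nat \<Rightarrow> int \<times> int) set \<Rightarrow> bool" where
  "regen_into e B \<equiv> regen e < \<infinity> \<and> post_regen pc pb v (fst e) (snd e) \<in> B"

lemma post_regen_eq: "regen e = enat n \<Longrightarrow> post_regen pc pb v (fst e) (snd e) = post e n"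
  by (simp add: post_regen_def post_def Let_def fun_eq_iff prod_eq_iff)

text \<open>Splitting over the values of the regeneration time lets the future be read from a fixed
  time.\<close>

lemma regen_into_sets:
  assumes "B \<in> sets traj_space"
  shows "{e. regen_into e B} \<in> sets (env_space \<rho> q UNIV UNIV)"
proof -
  let ?N = "env_space \<rho> q UNIV UNIV"
  have "regen_into e B \<longleftrightarrow> (\<exists>n. regen e = enat n \<and> post e n \<in> B)" for e
    using post_regen_eq[of e] by (cases "regen e") auto
  then have "{e. regen_into e B} = (\<Union>n. {e. regen e = enat n} \<inter> (\<lambda>e. post e n) -` B)"
    by auto
  also have "\<dots> \<in> sets ?N"
    using pred_regen_eq[of _ \<rho> q] measurable_sets[OF measurable_post assms, of _ \<rho> q]
    by (intro sets.countable_UN' sets.Int) (auto simp: pred_def)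
  finally show ?thesis .
qed

lemma good_sets:
  assumes "B \<in> sets traj_space"
  shows "{e. good e y \<and> Y e y \<in> B} \<in> sets (env_space \<rho> q UNIV UNIV)"
proof -
  have "(\<lambda>e. Y e y) \<in> env_space \<rho> q UNIV UNIV \<rightarrow>\<^sub>M traj_space"
    by (rule measurable_trajectory[OF measurable_Y])
  from measurable_sets[OF this assms]
  have "(\<lambda>e. Y e y) -` B \<in> sets (env_space \<rho> q UNIV UNIV)" by simp
  moreover have "{e. good e y} \<in> sets (env_space \<rho> q UNIV UNIV)"
    using pred_good[of y \<rho> q] by (simp add: pred_def)
  ultimately have "{e. good e y} \<inter> (\<lambda>e. Y e y) -` B \<in> sets (env_space \<rho> q UNIV UNIV)"
    by (rule sets.Int[rotated])
  then show ?thesis by (simp add: Int_def vimage_def)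
qed

end

section \<open>The law conditioned on a good origin and the conditional expectations\<close>

context rw_walk
begin

lemma env_vimage_sets: "D \<in> sets (env_space \<rho> q UNIV UNIV) \<Longrightarrow> {\<xi> \<in> space M. env \<xi> \<in> D} \<in> events"
  using measurable_sets[OF env_measurable, of D] by (simp add: vimage_def Int_def conj_commute)

lemma UNIV_traj [simp]: "UNIV \<in> sets traj_space"
  using sets.top[of traj_space] by (simp add: traj_space_def space_PiM)

abbreviation good_set :: "'a set" where
  "good_set \<equiv> {\<xi> \<in> space M. good_point pc pb v (om \<xi>) (U \<xi>) (0, 0)}"

lemma good_law_eq:
  assumes "B \<in> sets traj_space"
  shows "good_law B = prob {\<xi> \<in> space M. good_point pc pb v (om \<xi>) (U \<xi>) (0, 0) \<and>
    (\<lambda>i. Ypos pc pb (om \<xi>) (U \<xi>) (0, 0) i) \<in> B}"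
  using measure_env_law[OF good_sets[OF assms, of "(0,0)"]] by (simp add: good_law_def)

lemma good_set_events [measurable]: "good_set \<in> events"
  using env_vimage_sets[OF good_sets[OF UNIV_traj, of "(0,0)"]] by simp

lemma good_law_UNIV: "good_law UNIV = prob good_set"
  by (simp add: good_law_eq)

definition angle_law :: "(nat \<Rightarrow> int \<times> int) set \<Rightarrow> real" where
  "angle_law B = measure (P_angle M pc pb v om U)
     {\<xi> \<in> space M. (\<lambda>i. Ypos pc pb (om \<xi>) (U \<xi>) (0, 0) i) \<in> B}"

lemma traj_events:
  assumes "B \<in> sets traj_space"
  shows "{\<xi> \<in> space M. (\<lambda>i. Ypos pc pb (om \<xi>) (U \<xi>) (0, 0) i) \<in> B} \<in> events"
proof -
  have "(\<lambda>e. Y e (0,0)) \<in> env_space \<rho> q UNIV UNIV \<rightarrow>\<^sub>M traj_space"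
    by (rule measurable_trajectory[OF measurable_Y])
  from measurable_sets[OF this assms]
  have "(\<lambda>e. Y e (0,0)) -` B \<in> sets (env_space \<rho> q UNIV UNIV)" by simp
  from env_vimage_sets[OF this] show ?thesis by simp
qed

lemma measure_P_angle:
  assumes "prob good_set \<noteq> 0" "D \<in> events"
  shows "measure (P_angle M pc pb v om U) D = prob (good_set \<inter> D) / prob good_set"
  using assms unfolding P_angle_def by (subst measure_uniform_measure) (simp_all add: emeasure_eq_measure)

text \<open>If the good event is null both sides vanish, so the product form also covers a
  degenerate \<open>P_angle\<close>.\<close>

lemma good_law_eq_angle_law:
  assumes B: "B \<in> sets traj_space"
  shows "good_law B = angle_law B * good_law UNIV"
proof (cases "prob good_set = 0")
  case True
  have "good_law B \<le> prob good_set"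
    unfolding good_law_eq[OF B] by (rule finite_measure_mono) auto
  moreover have "0 \<le> good_law B" by (simp add: good_law_def)
  ultimately show ?thesis using True by (simp add: good_law_UNIV)
next
  case False
  have "good_set \<inter> {\<xi> \<in> space M. (\<lambda>i. Ypos pc pb (om \<xi>) (U \<xi>) (0, 0) i) \<in> B}
      = {\<xi> \<in> space M. good_point pc pb v (om \<xi>) (U \<xi>) (0, 0) \<and> (\<lambda>i. Ypos pc pb (om \<xi>) (U \<xi>) (0, 0) i) \<in> B}"
    by auto
  with False B show ?thesis
    by (simp add: angle_law_def measure_P_angle traj_events good_law_eq good_law_UNIV)
qed

text \<open>With \<open>c\<close> true this is the identity needed under the law conditioned on the
  origin being good, with \<open>c\<close> false the one under the unconditioned law.\<close>

lemma prob_regen_into: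
  assumes B: "B \<in> sets traj_space" and y: "y \<in> truncated"
  shows "prob {\<xi> \<in> space M. (c \<longrightarrow> good (env \<xi>) (0, 0)) \<and> pre (env \<xi>) = y \<and> regen_into (env \<xi>) B}
    = angle_law B * prob {\<xi> \<in> space M. (c \<longrightarrow> good (env \<xi>) (0, 0)) \<and> pre (env \<xi>) = y}"
proof -
  from truncatedD[OF y] obtain n p where y_eq: "y = (enat n, p)"
    and p: "\<And>i. n < i \<Longrightarrow> p i = (0, 0)"
    by blast
  \<comment> \<open>The same \<open>b\<close> serves for \<open>B\<close> and for
    \<open>UNIV\<close>; comparing the two instances eliminates it.\<close>
  obtain b where b: "\<And>B. B \<in> sets traj_space \<Longrightarrow>
      measure env_law {e. reg_at c e p n \<and> post e n \<in> B} = b * good_law B"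
    using regeneration_factorization by blast
  have meas: "{e. reg_at c e p n \<and> post e n \<in> B} \<in> sets (env_space \<rho> q UNIV UNIV)"
    if "B \<in> sets traj_space" for B
  proof -
    have "{e. reg_at c e p n} \<inter> (\<lambda>e. post e n) -` B \<in> sets (env_space \<rho> q UNIV UNIV)"
      using pred_reg_at[where \<rho> = \<rho> and q = q and c = c and p = p and n = n] measurable_sets[OF measurable_post that, of n \<rho> q]
      by (intro sets.Int) (simp_all add: pred_def)
    then show ?thesis by (simp add: Int_def vimage_def)
  qed
  have 1: "(c \<longrightarrow> good e (0, 0)) \<and> pre e = y \<longleftrightarrow> reg_at c e p n \<and> post e n \<in> UNIV" for e
    using pre_eq_iff[of n p e, OF p] by (auto simp: y_eq reg_at_def)
  have 2: "(c \<longrightarrow> good e (0, 0)) \<and> pre e = y \<and> regen_into e B \<longleftrightarrow> reg_at c e p n \<and> post e n \<in> B" for e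
    using 1[of e] post_regen_eq[of e n] by (auto simp: reg_at_def)
  have "prob {\<xi> \<in> space M. (c \<longrightarrow> good (env \<xi>) (0, 0)) \<and> pre (env \<xi>) = y \<and> regen_into (env \<xi>) B}
      = measure env_law {e. reg_at c e p n \<and> post e n \<in> B}"
    unfolding 2 by (subst measure_env_law[OF meas[OF B]]) simp
  moreover have "prob {\<xi> \<in> space M. (c \<longrightarrow> good (env \<xi>) (0, 0)) \<and> pre (env \<xi>) = y}
      = measure env_law {e. reg_at c e p n \<and> post e n \<in> UNIV}"
    unfolding 1 by (subst measure_env_law[OF meas[OF UNIV_traj]]) simp
  ultimately show ?thesis
    using b[OF B] b[OF UNIV_traj] good_law_eq_angle_law[OF B] by simp
qed

text \<open>One statement for both laws: \<open>c\<close> false with \<open>r = 1\<close> gives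
  \<open>M\<close>, and \<open>c\<close> true with \<open>r\<close> the probability of the good
  event gives \<open>P_angle\<close>. The divisor \<open>r\<close> is the same on both sides of the
  fibre identity.\<close>

lemma real_cond_exp_regen:
  assumes B: "B \<in> sets traj_space" and P: "prob_space P" "space P = space M" "sets P = sets M"
    and meas: "\<And>D. D \<in> events \<Longrightarrow>
      measure P D = prob {\<xi> \<in> space M. (c \<longrightarrow> good (env \<xi>) (0, 0)) \<and> \<xi> \<in> D} / r"
  shows "AE \<xi> in P. regen (env \<xi>) < \<infinity> \<longrightarrow>
    real_cond_exp P (regen_sigma P pc pb v om U) (indicator {\<xi> \<in> space M. regen_into (env \<xi>) B}) \<xi>
      = angle_law B"
proof -
  let ?f = "\<lambda>\<xi>. pre (env \<xi>)" and ?K = "count_space (UNIV :: enat set) \<Otimes>\<^sub>M traj_space"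
  let ?T = "{t :: enat \<times> (nat \<Rightarrow> int \<times> int). fst t < \<infinity>}"
  let ?X = "{\<xi> \<in> space M. regen_into (env \<xi>) B}"
  have fst_pre: "fst (pre_regen pc pb v m u) = regen_time pc pb v m u" for m u
    by (simp add: pre_regen_def)
  have fib: "{\<xi> \<in> space M. ?f \<xi> = y} \<in> events" if "y \<in> truncated" for y
  proof -
    from truncatedD[OF that] obtain n p where y: "y = (enat n, p)"
      "\<And>i. n < i \<Longrightarrow> p i = (0, 0)"
      by blast
    have "?f \<xi> = y \<longleftrightarrow> reg_at False (env \<xi>) p n" for \<xi>
      unfolding y(1) by (rule pre_eq_iff[OF y(2)])
    then show ?thesis
      using env_vimage_sets[OF pred_reg_at[unfolded pred_def, of \<rho> q False p n]] by simp
  qed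
  have X: "?X \<in> events"
    using env_vimage_sets[OF regen_into_sets[OF B]] by simp
  have "AE \<xi> in P. ?f \<xi> \<in> ?T \<longrightarrow>
      real_cond_exp P (vimage_algebra (space P) ?f ?K) (indicator ?X) \<xi> = angle_law B"
  proof (rule real_cond_exp_eq_const[OF P(1) _ _ countable_truncated])
    have "?f \<in> M \<rightarrow>\<^sub>M ?K"
      by (rule measurable_compose[OF env_measurable measurable_pre])
    then show "?f \<in> P \<rightarrow>\<^sub>M ?K"
      using measurable_cong_sets[OF P(3) refl] by blast
    have "fst -` {..<\<infinity>} \<inter> space ?K \<in> sets ?K"
      by (rule measurable_sets[OF measurable_fst]) simp
    moreover have "fst -` {..<\<infinity>} \<inter> space ?K = ?T"
      by (auto simp: space_pair_measure traj_space_def space_PiM)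
    ultimately show "?T \<in> sets ?K" by (simp only:)
    show "?f \<xi> \<in> truncated" if "?f \<xi> \<in> ?T" for \<xi>
      using pre_in_truncated[of "env \<xi>"] that by simp
    show "?X \<in> sets P" using X P(3) by simp
    show "?f \<xi> \<in> ?T" if "\<xi> \<in> ?X" for \<xi>
      using that by (simp add: fst_pre)
    show "0 \<le> angle_law B" by (simp add: angle_law_def)
    fix y assume y: "y \<in> truncated \<inter> ?T"
    then show "{\<xi> \<in> space P. ?f \<xi> = y} \<in> sets P" using fib P by simp
    have "{\<xi> \<in> space M. ?f \<xi> = y} \<inter> ?X \<in> events" using fib X y by (intro sets.Int) auto
    moreover have "{\<xi> \<in> space M. (c \<longrightarrow> good (env \<xi>) (0, 0)) \<and> \<xi> \<in> {\<xi> \<in> space M. ?f \<xi> = y} \<inter> ?X}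
        = {\<xi> \<in> space M. (c \<longrightarrow> good (env \<xi>) (0, 0)) \<and> ?f \<xi> = y \<and> regen_into (env \<xi>) B}"
      by auto
    moreover have "{\<xi> \<in> space M. (c \<longrightarrow> good (env \<xi>) (0, 0)) \<and> \<xi> \<in> {\<xi> \<in> space M. ?f \<xi> = y}}
        = {\<xi> \<in> space M. (c \<longrightarrow> good (env \<xi>) (0, 0)) \<and> ?f \<xi> = y}"
      by auto
    ultimately show "measure P ({\<xi> \<in> space P. ?f \<xi> = y} \<inter> ?X)
        = angle_law B * measure P {\<xi> \<in> space P. ?f \<xi> = y}"
      unfolding P(2) using y fib[of y] prob_regen_into[OF B, of y c] by (simp only: meas Int_iff) simp
  qed
  then show ?thesis
    by (simp add: fst_pre regen_sigma_def P(2))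
qed

end

theorem theorem4p1:
  fixes M :: "'a measure"
    and om :: "'a \<Rightarrow> (int \<Rightarrow> int) \<Rightarrow> nat"
    and U :: "'a \<Rightarrow> int \<times> int \<Rightarrow> real"
    and q pc pb \<rho> vstar c0 \<gamma> :: real
  assumes model: "rw_model M om U \<rho> q"
    and q: "0 < q" "q < 1"
    and pc: "0 \<le> pc" "pc \<le> 1"
    and pb: "0 \<le> pb" "pb \<le> 1"
    and vb_pos: "2 * pb - 1 > 0"
    and vc: "2 * pc - 1 > -1"
    and rho: "0 < \<rho>"
    and vstar: "0 < vstar" "vstar < 2 * pb - 1"
    and c0: "0 < c0" and gamma: "1 < \<gamma>"
    and ballistic: "\<forall>L::nat. 1 \<le> L \<longrightarrow>
        measure M {\<xi> \<in> space M. \<exists>n::nat. 1 \<le> n \<and>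
            real_of_int (Xpos pc pb (om \<xi>) (U \<xi>) (0,0) n) < real n * vstar - real L}
          \<le> (1 / c0) * exp (- c0 * (ln (real L)) powr \<gamma>)"
  shows "\<forall>B \<in> sets traj_space.
     (AE \<xi> in M. regen_time pc pb (vstar / 3) (om \<xi>) (U \<xi>) < \<infinity> \<longrightarrow>
        real_cond_exp M (regen_sigma M pc pb (vstar / 3) om U)
          (indicator {\<xi> \<in> space M. regen_time pc pb (vstar / 3) (om \<xi>) (U \<xi>) < \<infinity> \<and>
                                    post_regen pc pb (vstar / 3) (om \<xi>) (U \<xi>) \<in> B}) \<xi>
        = measure (P_angle M pc pb (vstar / 3) om U)
            {\<xi> \<in> space M. (\<lambda>i. Ypos pc pb (om \<xi>) (U \<xi>) (0,0) i) \<in> B})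
   \<and> (AE \<xi> in P_angle M pc pb (vstar / 3) om U.
        regen_time pc pb (vstar / 3) (om \<xi>) (U \<xi>) < \<infinity> \<longrightarrow>
        real_cond_exp (P_angle M pc pb (vstar / 3) om U)
            (regen_sigma (P_angle M pc pb (vstar / 3) om U) pc pb (vstar / 3) om U)
          (indicator {\<xi> \<in> space M. regen_time pc pb (vstar / 3) (om \<xi>) (U \<xi>) < \<infinity> \<and>
                                    post_regen pc pb (vstar / 3) (om \<xi>) (U \<xi>) \<in> B}) \<xi>
        = measure (P_angle M pc pb (vstar / 3) om U)
            {\<xi> \<in> space M. (\<lambda>i. Ypos pc pb (om \<xi>) (U \<xi>) (0,0) i) \<in> B})"
proof (intro ballI conjI)
  fix B assume B: "B \<in> sets traj_space"
  have "prob_space M" using model by (simp add: rw_model_def)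
  \<comment> \<open>The slope lies in (0, 1) because
    \<open>vstar < 2 * pb - 1 \<le> 1\<close>.\<close>
  then interpret rw_walk M om U \<rho> q pc pb "vstar / 3"
    using model q vstar pb by (simp add: rw_walk_def rw_environment_def rw_environment_axioms_def walk_params_def)
  \<comment> \<open>With \<open>c\<close> false the condition on the origin is void, so this is the
    unconditioned law in the form required for \<open>P\<close>.\<close>
  have meas: "measure M D = prob {\<xi> \<in> space M. (False \<longrightarrow> good (env \<xi>) (0, 0)) \<and> \<xi> \<in> D} / 1"
    if "D \<in> events" for D
    using sets.sets_into_space[OF that] by (auto intro!: arg_cong[where f = prob])
  show "AE \<xi> in M. regen_time pc pb (vstar / 3) (om \<xi>) (U \<xi>) < \<infinity> \<longrightarrow>
        real_cond_exp M (regen_sigma M pc pb (vstar / 3) om U)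
          (indicator {\<xi> \<in> space M. regen_time pc pb (vstar / 3) (om \<xi>) (U \<xi>) < \<infinity> \<and>
                                    post_regen pc pb (vstar / 3) (om \<xi>) (U \<xi>) \<in> B}) \<xi>
        = measure (P_angle M pc pb (vstar / 3) om U)
            {\<xi> \<in> space M. (\<lambda>i. Ypos pc pb (om \<xi>) (U \<xi>) (0,0) i) \<in> B}"
    using real_cond_exp_regen[OF B prob_space_axioms refl refl meas] by (simp add: angle_law_def)
  show "AE \<xi> in P_angle M pc pb (vstar / 3) om U.
        regen_time pc pb (vstar / 3) (om \<xi>) (U \<xi>) < \<infinity> \<longrightarrow>
        real_cond_exp (P_angle M pc pb (vstar / 3) om U)
            (regen_sigma (P_angle M pc pb (vstar / 3) om U) pc pb (vstar / 3) om U)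
          (indicator {\<xi> \<in> space M. regen_time pc pb (vstar / 3) (om \<xi>) (U \<xi>) < \<infinity> \<and>
                                    post_regen pc pb (vstar / 3) (om \<xi>) (U \<xi>) \<in> B}) \<xi>
        = measure (P_angle M pc pb (vstar / 3) om U)
            {\<xi> \<in> space M. (\<lambda>i. Ypos pc pb (om \<xi>) (U \<xi>) (0,0) i) \<in> B}"
  \<comment> \<open>If the good event is null, the convention for division by zero makes
    \<open>P_angle\<close> the zero measure, and the claim is vacuous.\<close>
  proof (cases "prob good_set = 0")
    case True
    then have "emeasure (P_angle M pc pb (vstar / 3) om U) (space M) = 0"
      unfolding P_angle_def
      by (subst emeasure_uniform_measure) (auto simp: Int_absorb2 emeasure_eq_measure)
    then have "space M \<in> null_sets (P_angle M pc pb (vstar / 3) om U)"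
      by (auto simp: null_sets_def P_angle_def)
    moreover have "space (P_angle M pc pb (vstar / 3) om U) = space M"
      by (simp add: P_angle_def)
    ultimately show ?thesis
      by (intro AE_I'[of "space M"]) blast+
  next
    case False
    have P: "prob_space (P_angle M pc pb (vstar / 3) om U)"
      "space (P_angle M pc pb (vstar / 3) om U) = space M" "sets (P_angle M pc pb (vstar / 3) om U) = sets M"
      using False by (auto simp: P_angle_def emeasure_eq_measure intro!: prob_space_uniform_measure)
    have "measure (P_angle M pc pb (vstar / 3) om U) D
        = prob {\<xi> \<in> space M. (True \<longrightarrow> good (env \<xi>) (0, 0)) \<and> \<xi> \<in> D} / prob good_set"
      if "D \<in> events" for D
    proof -
      have "good_set \<inter> D = {\<xi> \<in> space M. (True \<longrightarrow> good (env \<xi>) (0, 0)) \<and> \<xi> \<in> D}"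
        by auto
      then show ?thesis by (simp only: measure_P_angle[OF False that])
    qed
    from real_cond_exp_regen[OF B P this] show ?thesis by (simp add: angle_law_def)
  qed
qed

end
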